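(* Let $$p(z,w)=az+bw+cw^2+w^3q(w)+z^2r(z)+\sum_{i,j\ge1}a_{i,j}z^iw^j$$ be a polynomial, where $a,b,c$ and $a_{i,j}$ are complex scalars (finitely many $a_{i,j}$ nonzero) and $q(w)$, $r(z)$ are single-variable polynomials. Let $\mathcal{Q}_p=H^2(\triangle_H)\ominus pH^2(\triangle_H)$ and suppose that $\mathcal{Q}_p=\bigoplus_{m=0}^\infty(\mathfrak{F}_m\cap\mathcal{Q}_p)$. If either $b\ne0$, or $a\neq0$ and $b=c=0$, then the quotient module $\mathcal{Q}_p$ is doubly commuting.
   Context: The Hartogs triangle is $\triangle_H=\{(z,w)\in\mathbb{C}^2: |z|<|w|<1\}$. The Hardy space $H^2(\triangle_H)$ is the Hilbert space of holomorphic $f$ on $\triangle_H$ with $\|f\|^2=\sup_{s,t\in(0,1)}\frac{1}{4\pi^2}\int_0^{2\pi}\int_0^{2\pi}|f(ste^{i\theta},te^{i\gamma})|^2\,st^2\,d\theta\,d\gamma<\infty$; the functions $\frac1w(\frac zw)^iw^j$, $i,j\ge0$, form an orthonormal basis. For $m\in\mathbb{Z}_+$, $\mathfrak{F}_m$ is the span of $\frac1w(\frac zw)^{m-j}w^j$, $0\le j\le m$. $M_z,M_w$ are multiplication by $z$ and $w$. A quotient module is a closed subspace $\mathcal{Q}$ invariant under $M_z^*$ and $M_w^*$; put $Q_z=P_{\mathcal{Q}}M_z|_{\mathcal{Q}}$, $Q_w=P_{\mathcal{Q}}M_w|_{\mathcal{Q}}$. $\mathcal{Q}$ is doubly commuting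 if $Q_z^*Q_w=Q_wQ_z^*$. $\mathcal{Q}_p$ is the orthogonal complement of $\{pg:g\in H^2(\triangle_H)\}$. *)

theory Defs
  imports "HOL-Analysis.Analysis" "HOL-Computational_Algebra.Polynomial"
begin

definition hartogs_triangle :: "(complex \<times> complex) set" where
  "hartogs_triangle = {(z, w). norm z < norm w \<and> norm w < 1}"

text \<open>Holomorphy in two variables, on an open set: complex (Frechet) differentiability at every
  point, i.e. the derivative is complex linear.\<close>

definition holomorphic2_on :: "(complex \<times> complex \<Rightarrow> complex) \<Rightarrow> (complex \<times> complex) set \<Rightarrow> bool" where
  "holomorphic2_on f S \<longleftrightarrow>
     (\<forall>x\<in>S. \<exists>A B. (f has_derivative (\<lambda>(h, k). A * h + B * k)) (at x))"

definition hardy_mean :: "(complex \<times> complex \<Rightarrow> complex) \<Rightarrow> real \<Rightarrow> real \<Rightarrow> real" where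
  "hardy_mean f s t = 1 / (4 * pi\<^sup>2) *
     integral {0..2*pi} (\<lambda>\<gamma>. integral {0..2*pi} (\<lambda>\<theta>.
       (norm (f (of_real (s * t) * cis \<theta>, of_real t * cis \<gamma>)))\<^sup>2 * (s * t\<^sup>2)))"

text \<open>Functions on the triangle are represented by total functions vanishing off it, so that
  equality of functions is equality on the triangle.\<close>

definition hardy :: "(complex \<times> complex \<Rightarrow> complex) set" where
  "hardy = {f. holomorphic2_on f hartogs_triangle \<and> (\<forall>x. x \<notin> hartogs_triangle \<longrightarrow> f x = 0) \<and>
     bdd_above ((\<lambda>(s, t). hardy_mean f s t) ` ({0<..<1} \<times> {0<..<1}))}"

definition hardy_norm :: "(complex \<times> complex \<Rightarrow> complex) \<Rightarrow> real" where
  "hardy_norm f = sqrt (SUP (s, t)\<in>{0<..<1} \<times> {0<..<1}. hardy_mean f s t)"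

text \<open>The inner product, linear in the first argument, recovered from the norm by polarization.\<close>

definition hardy_inner ::
  "(complex \<times> complex \<Rightarrow> complex) \<Rightarrow> (complex \<times> complex \<Rightarrow> complex) \<Rightarrow> complex" where
  "hardy_inner f g =
     (\<Sum>k<4. \<i> ^ k * of_real ((hardy_norm (\<lambda>x. f x + \<i> ^ k * g x))\<^sup>2)) / 4"

definition hardy_lim ::
  "(nat \<Rightarrow> complex \<times> complex \<Rightarrow> complex) \<Rightarrow> (complex \<times> complex \<Rightarrow> complex) \<Rightarrow> bool" where
  "hardy_lim F f \<longleftrightarrow> (\<lambda>n. hardy_norm (\<lambda>x. F n x - f x)) \<longlonglongrightarrow> 0"

definition closed_subspace :: "(complex \<times> complex \<Rightarrow> complex) set \<Rightarrow> bool" where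
  "closed_subspace V \<longleftrightarrow> V \<subseteq> hardy \<and> (\<lambda>x. 0) \<in> V \<and>
     (\<forall>f\<in>V. \<forall>g\<in>V. (\<lambda>x. f x + g x) \<in> V) \<and>
     (\<forall>c. \<forall>f\<in>V. (\<lambda>x. c * f x) \<in> V) \<and>
     (\<forall>F f. (\<forall>n. F n \<in> V) \<and> f \<in> hardy \<and> hardy_lim F f \<longrightarrow> f \<in> V)"

definition orth_compl ::
  "(complex \<times> complex \<Rightarrow> complex) set \<Rightarrow> (complex \<times> complex \<Rightarrow> complex) set" where
  "orth_compl V = {f \<in> hardy. \<forall>g\<in>V. hardy_inner f g = 0}"

text \<open>The orthogonal projection onto \<open>V\<close> and the adjoint of an operator \<open>T\<close> from \<open>V\<close> to \<open>V\<close>;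
  the descriptions are meaningful for closed subspaces \<open>V\<close> and bounded linear \<open>T\<close>.\<close>

definition orth_proj :: "(complex \<times> complex \<Rightarrow> complex) set \<Rightarrow>
    (complex \<times> complex \<Rightarrow> complex) \<Rightarrow> (complex \<times> complex \<Rightarrow> complex)" where
  "orth_proj V f = (THE h. h \<in> V \<and> (\<forall>g\<in>V. hardy_inner (\<lambda>x. f x - h x) g = 0))"

definition adjoint_on :: "(complex \<times> complex \<Rightarrow> complex) set \<Rightarrow>
    ((complex \<times> complex \<Rightarrow> complex) \<Rightarrow> (complex \<times> complex \<Rightarrow> complex)) \<Rightarrow>
    (complex \<times> complex \<Rightarrow> complex) \<Rightarrow> (complex \<times> complex \<Rightarrow> complex)" where
  "adjoint_on V T f = (THE h. h \<in> V \<and> (\<forall>g\<in>V. hardy_inner h g = hardy_inner f (T g)))"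

definition mult_z :: "(complex \<times> complex \<Rightarrow> complex) \<Rightarrow> (complex \<times> complex \<Rightarrow> complex)" where
  "mult_z f = (\<lambda>(z, w). z * f (z, w))"

definition mult_w :: "(complex \<times> complex \<Rightarrow> complex) \<Rightarrow> (complex \<times> complex \<Rightarrow> complex)" where
  "mult_w f = (\<lambda>(z, w). w * f (z, w))"

definition quotient_module :: "(complex \<times> complex \<Rightarrow> complex) set \<Rightarrow> bool" where
  "quotient_module Q \<longleftrightarrow> closed_subspace Q \<and>
     (\<forall>f\<in>Q. adjoint_on hardy mult_z f \<in> Q) \<and> (\<forall>f\<in>Q. adjoint_on hardy mult_w f \<in> Q)"

definition compress_z :: "(complex \<times> complex \<Rightarrow> complex) set \<Rightarrow>
    (complex \<times> complex \<Rightarrow> complex) \<Rightarrow> (complex \<times> complex \<Rightarrow> complex)" where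
  "compress_z Q f = orth_proj Q (mult_z f)"

definition compress_w :: "(complex \<times> complex \<Rightarrow> complex) set \<Rightarrow>
    (complex \<times> complex \<Rightarrow> complex) \<Rightarrow> (complex \<times> complex \<Rightarrow> complex)" where
  "compress_w Q f = orth_proj Q (mult_w f)"

definition doubly_commuting :: "(complex \<times> complex \<Rightarrow> complex) set \<Rightarrow> bool" where
  "doubly_commuting Q \<longleftrightarrow> quotient_module Q \<and>
     (\<forall>f\<in>Q. adjoint_on Q (compress_z Q) (compress_w Q f)
           = compress_w Q (adjoint_on Q (compress_z Q) f))"

definition hardy_basis :: "nat \<Rightarrow> nat \<Rightarrow> complex \<times> complex \<Rightarrow> complex" where
  "hardy_basis i j = (\<lambda>(z, w). if (z, w) \<in> hartogs_triangle then 1 / w * (z / w) ^ i * w ^ j else 0)"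

definition homog_space :: "nat \<Rightarrow> (complex \<times> complex \<Rightarrow> complex) set" where
  "homog_space m = {f. \<exists>c. f = (\<lambda>x. \<Sum>j\<le>m. c j * hardy_basis (m - j) j x)}"

definition principal_quotient :: "(complex \<times> complex \<Rightarrow> complex) \<Rightarrow> (complex \<times> complex \<Rightarrow> complex) set" where
  "principal_quotient p = orth_compl {\<lambda>x. p x * g x | g. g \<in> hardy}"

text \<open>The Hilbert space direct sum, inside the Hardy space, of a sequence of mutually orthogonal
  closed subspaces: all norm-convergent series with one term from each.\<close>

definition hilbert_sum ::
  "(nat \<Rightarrow> (complex \<times> complex \<Rightarrow> complex) set) \<Rightarrow> (complex \<times> complex \<Rightarrow> complex) set" where
  "hilbert_sum V = {f \<in> hardy. \<exists>g. (\<forall>m. g m \<in> V m) \<and> hardy_lim (\<lambda>n x. \<Sum>m<n. g m x) f}"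

end

theory Submission
  imports Defs "HOL-Complex_Analysis.Complex_Analysis"
begin

text \<open>
  In the coordinates \<open>u = z / w\<close>, \<open>v = w\<close> the space is the Hardy space of the bidisc: writing
  \<open>f (z, w) = F (u, v) / v\<close>, the mean \<open>hardy_mean f s t\<close> is \<open>s\<close> times the mean square of \<open>F\<close> over
  the torus \<open>|u| = s\<close>, \<open>|v| = t\<close>, and the basis function with indices \<open>i, j\<close> corresponds to
  \<open>u ^ i * v ^ j\<close>. Multiplication by \<open>z\<close> and \<open>w\<close> becomes multiplication by \<open>u * v\<close> and \<open>v\<close>.

  The theorem is then a statement about lowest terms. The space of index \<open>m\<close> in the grading consists
  of the forms of degree \<open>m\<close> in \<open>u, v\<close>, and \<open>z ^ k * w ^ l\<close> has degree \<open>2 * k + l\<close>. If \<open>b \<noteq> 0\<close>,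
  then \<open>b * w\<close> is the only term of \<open>p\<close> of degree at most one; if \<open>a \<noteq> 0\<close> and \<open>b = c = 0\<close>, then
  \<open>a * z\<close> is the only term of degree at most two. A form \<open>f\<close> orthogonal to all multiples \<open>p * e\<close> of
  basis functions \<open>e\<close> sees only this leading term when the degree of \<open>e\<close> is chosen suitably, so its
  coefficient vanishes at every index which the leading monomial can reach, in both cases at all
  \<open>(i, j)\<close> with \<open>i, j \<ge> 1\<close>
  (lemma \<open>homogeneous_orthogonal_coeff_eq_0\<close>). As the quotient module \<open>Q\<close> is the closed span of its
  forms, no element of \<open>Q\<close> has a nonzero coefficient at such an index, whereas every multiple of
  \<open>z = u * v\<close> has nonzero coefficients only there. So \<open>z * g\<close> is orthogonal to \<open>Q\<close> for every \<open>g\<close>: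
  the compression of \<open>M_z\<close> to \<open>Q\<close> is zero, and both products in the definition of double
  commutation vanish (lemma \<open>doubly_commuting_if_no_mixed_terms\<close>).

  Most of the work is to identify the Hardy space with the square-summable double sequences.
  Parseval's identity on the torus (\<open>torus_parseval\<close>) computes the means of a function given by an
  expansion in the basis; this determines the norm and, by polarization, the inner product
  (\<open>hardy_inner_has_sum\<close>). That every Hardy function has an expansion (\<open>hardy_imp_expands\<close>) is the
  analytic part. The function \<open>F\<close> is given only where \<open>v \<noteq> 0\<close>, so a priori negative powers of
  \<open>v\<close> occur; they are excluded because the bound on the means persists as \<open>t\<close> tends to zero. To verify that \<open>Q\<close> is a quotient module, the adjoint of \<open>M_w\<close> is realised as a backward shift
  of the coefficients (\<open>backward_shift_w\<close>).
\<close>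

section \<open>Fourier series on the torus\<close>

lemma integral_cis_int:
  fixes k :: int
  shows "integral {0..2*pi} (\<lambda>x. cis (of_int k * x)) = (if k = 0 then 2 * pi else 0)"
proof (cases "k = 0")
  case False
  define F where "F = (\<lambda>x::real. cis (of_int k * x) / (\<i> * of_int k))"
  have "((\<lambda>x. cis (of_int k * x)) has_integral (F (2*pi) - F 0)) {0..2*pi}"
  proof (rule fundamental_theorem_of_calculus)
    fix x :: real assume "x \<in> {0..2*pi}"
    have "((\<lambda>x. cis (of_int k * x)) has_vector_derivative (of_int k * (\<i> * cis (of_int k * x)))) (at x within {0..2*pi})"
      unfolding has_vector_derivative_def
      by (auto intro!: derivative_eq_intros simp: scaleR_conv_of_real mult_ac)
    then have "(F has_vector_derivative (of_int k * (\<i> * cis (of_int k * x)) / (\<i> * of_int k))) (at x within {0..2*pi})"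
      unfolding F_def by (rule has_vector_derivative_divide)
    then show "(F has_vector_derivative cis (of_int k * x)) (at x within {0..2*pi})"
      using False by (simp add: field_simps)
  qed auto
  moreover have "F (2*pi) = F 0"
    unfolding F_def using cis_multiple_2pi[of "of_int k"] by (simp add: mult_ac)
  ultimately show ?thesis using False by (simp add: integral_unique)
qed (simp add: scaleR_conv_of_real)

definition torus_integral :: "(real \<Rightarrow> real \<Rightarrow> complex) \<Rightarrow> complex" where
  "torus_integral h = integral {0..2*pi} (\<lambda>\<gamma>. integral {0..2*pi} (\<lambda>\<theta>. h \<theta> \<gamma>))"

abbreviation (input) torus :: "(real \<times> real) set" where
  "torus \<equiv> {0..2*pi} \<times> {0..2*pi}"

lemma continuous_on_inner_integral:
  fixes h :: "real \<Rightarrow> real \<Rightarrow> 'a::banach"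
  assumes "continuous_on ({a..b} \<times> {c..d}) (\<lambda>(\<theta>, \<gamma>). h \<theta> \<gamma>)"
  shows "continuous_on {c..d} (\<lambda>\<gamma>. integral {a..b} (\<lambda>\<theta>. h \<theta> \<gamma>))"
proof -
  have "continuous_on ({c..d} \<times> cbox a b) (\<lambda>x. (\<lambda>(\<theta>, \<gamma>). h \<theta> \<gamma>) (snd x, fst x))"
    by (rule continuous_on_compose2[OF assms]) (auto intro!: continuous_intros)
  then have "continuous_on ({c..d} \<times> cbox a b) (\<lambda>(\<gamma>, \<theta>). h \<theta> \<gamma>)"
    by (simp add: case_prod_unfold)
  from integral_continuous_on_param[OF this] show ?thesis by simp
qed

lemma continuous_on_slice:
  assumes "continuous_on (S \<times> T) (\<lambda>(\<theta>, \<gamma>). h \<theta> \<gamma>)" "\<gamma> \<in> T"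
  shows "continuous_on S (\<lambda>\<theta>. h \<theta> \<gamma>)"
proof -
  have "continuous_on S (\<lambda>\<theta>. (\<lambda>(\<theta>, \<gamma>). h \<theta> \<gamma>) (\<theta>, \<gamma>))"
    by (rule continuous_on_compose2[OF assms(1)]) (use assms(2) in \<open>auto intro!: continuous_intros\<close>)
  then show ?thesis by simp
qed

lemma integral_complex_of_real_continuous:
  fixes a b :: real
  assumes "continuous_on {a..b} f"
  shows "integral {a..b} (\<lambda>x. complex_of_real (f x)) = of_real (integral {a..b} f)"
  by (intro integral_unique has_integral_of_real integrable_integral integrable_continuous_real assms)

lemma integral_has_sum:
  fixes g :: "'i \<Rightarrow> real \<Rightarrow> 'a::banach"
  assumes cont: "\<And>x. x \<in> X \<Longrightarrow> continuous_on {a..b} (g x)"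
    and bound: "\<And>x y. x \<in> X \<Longrightarrow> y \<in> {a..b} \<Longrightarrow> norm (g x y) \<le> M x"
    and M: "M summable_on X"
    and G: "\<And>y. y \<in> {a..b} \<Longrightarrow> ((\<lambda>x. g x y) has_sum G y) X"
  shows "((\<lambda>x. integral {a..b} (g x)) has_sum integral {a..b} G) X"
proof -
  have "uniform_limit {a..b} (\<lambda>F y. \<Sum>x\<in>F. if x \<in> X then g x y else 0) G (finite_subsets_at_top X)"
  proof (rule uniform_limit_cong[THEN iffD1])
    show "uniform_limit {a..b} (\<lambda>F y. \<Sum>x\<in>F. g x y) G (finite_subsets_at_top X)"
      by (rule Weierstrass_m_test_general') (use bound M G in auto)
    show "\<forall>\<^sub>F F in finite_subsets_at_top X. \<forall>y\<in>{a..b}. (\<Sum>x\<in>F. g x y) = (\<Sum>x\<in>F. if x \<in> X then g x y else 0)"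
      by (rule eventually_finite_subsets_at_top_weakI) (auto intro!: sum.cong)
  qed auto
  moreover have "continuous_on {a..b} (\<lambda>y. \<Sum>x\<in>F. if x \<in> X then g x y else 0)" for F
  proof (rule continuous_on_sum)
    fix x show "continuous_on {a..b} (\<lambda>y. if x \<in> X then g x y else 0)"
      by (cases "x \<in> X") (auto intro: cont)
  qed
  moreover have "finite_subsets_at_top X \<noteq> bot" by simp
  ultimately obtain I J where I: "\<And>F. ((\<lambda>y. \<Sum>x\<in>F. if x \<in> X then g x y else 0) has_integral I F) {a..b}"
    and J: "(G has_integral J) {a..b}" and lim: "(I \<longlongrightarrow> J) (finite_subsets_at_top X)"
    by (rule uniform_limit_integral) blast
  have "\<forall>\<^sub>F F in finite_subsets_at_top X. I F = (\<Sum>x\<in>F. integral {a..b} (g x))"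
  proof (rule eventually_finite_subsets_at_top_weakI)
    fix F assume F: "finite F" "F \<subseteq> X"
    have "I F = integral {a..b} (\<lambda>y. \<Sum>x\<in>F. if x \<in> X then g x y else 0)"
      by (rule integral_unique[OF I, symmetric])
    also have "\<dots> = integral {a..b} (\<lambda>y. \<Sum>x\<in>F. g x y)"
      using F by (intro integral_cong sum.cong) auto
    also have "\<dots> = (\<Sum>x\<in>F. integral {a..b} (g x))"
      using F by (intro integral_sum integrable_continuous_real cont) auto
    finally show "I F = (\<Sum>x\<in>F. integral {a..b} (g x))" .
  qed
  with lim have "((\<lambda>F. \<Sum>x\<in>F. integral {a..b} (g x)) \<longlongrightarrow> J) (finite_subsets_at_top X)"
    by (simp add: tendsto_cong)
  then show ?thesis using J by (simp add: has_sum_def integral_unique)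
qed

text \<open>Both iterated integrations exchange with the sum because the terms are dominated by a summable
  family, uniformly on the torus.\<close>

lemma torus_integral_has_sum:
  assumes cont: "\<And>x. x \<in> X \<Longrightarrow> continuous_on torus (\<lambda>(\<theta>, \<gamma>). h x \<theta> \<gamma>)"
    and bound: "\<And>x \<theta> \<gamma>. x \<in> X \<Longrightarrow> norm (h x \<theta> \<gamma>) \<le> M x"
    and M: "M summable_on X"
    and H: "\<And>\<theta> \<gamma>. ((\<lambda>x. h x \<theta> \<gamma>) has_sum H \<theta> \<gamma>) X"
  shows "((\<lambda>x. torus_integral (h x)) has_sum torus_integral H) X"
  unfolding torus_integral_def
proof (rule integral_has_sum)
  show "continuous_on {0..2*pi} (\<lambda>\<gamma>. integral {0..2*pi} (\<lambda>\<theta>. h x \<theta> \<gamma>))" if "x \<in> X" for x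
    by (rule continuous_on_inner_integral) (rule cont[OF that])
  show "((\<lambda>x. integral {0..2*pi} (\<lambda>\<theta>. h x \<theta> \<gamma>)) has_sum integral {0..2*pi} (\<lambda>\<theta>. H \<theta> \<gamma>)) X"
    if "\<gamma> \<in> {0..2*pi}" for \<gamma>
    by (rule integral_has_sum[where M = M]) (auto intro: bound H M continuous_on_slice[OF cont] that)
  show "norm (integral {0..2*pi} (\<lambda>\<theta>. h x \<theta> \<gamma>)) \<le> M x * (2*pi - 0)"
    if "x \<in> X" "\<gamma> \<in> {0..2*pi}" for x \<gamma>
    by (rule integral_bound) (auto intro: bound that continuous_on_slice[OF cont])
  show "(\<lambda>x. M x * (2*pi - 0)) summable_on X"
    using M by (rule summable_on_cmult_left)
qed

text \<open>The series for \<open>S\<close> converges uniformly. Integrating it termwise against a single character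
  yields the coefficient of that character by orthogonality, and integrating \<open>S\<close> termwise against
  its own conjugate then yields the sum of squares. Besides the identity, the continuity of \<open>S\<close>
  comes out as a uniform limit.\<close>

lemma torus_parseval:
  fixes b :: "'i \<Rightarrow> complex" and k l :: "'i \<Rightarrow> int"
  assumes inj: "inj (\<lambda>x. (k x, l x))"
    and b: "(\<lambda>x. norm (b x)) summable_on UNIV"
    and S: "\<And>\<theta> \<gamma>. ((\<lambda>x. b x * (cis (of_int (k x) * \<theta>) * cis (of_int (l x) * \<gamma>))) has_sum S \<theta> \<gamma>) UNIV"
  shows "((\<lambda>x. (norm (b x))\<^sup>2) has_sum (integral {0..2*pi} (\<lambda>\<gamma>. integral {0..2*pi} (\<lambda>\<theta>. (norm (S \<theta> \<gamma>))\<^sup>2)) / (4*pi\<^sup>2))) UNIV"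
    and "continuous_on torus (\<lambda>(\<theta>, \<gamma>). S \<theta> \<gamma>)"
proof -
  define e where "e = (\<lambda>x \<theta> \<gamma>. cis (of_int (k x) * \<theta>) * cis (of_int (l x) * \<gamma>))"
  have e_norm: "norm (e x \<theta> \<gamma>) = 1" for x \<theta> \<gamma> by (simp add: e_def norm_mult)
  have e_cont: "continuous_on A (\<lambda>(\<theta>, \<gamma>). e x \<theta> \<gamma>)" for A x
    unfolding e_def case_prod_unfold by (intro continuous_intros)
  have ul: "uniform_limit UNIV (\<lambda>F y. \<Sum>x\<in>F. b x * e x (fst y) (snd y)) (\<lambda>y. S (fst y) (snd y)) (finite_subsets_at_top UNIV)"
    by (rule Weierstrass_m_test_general'[OF _ _ b]) (use S in \<open>auto simp: norm_mult e_norm e_def\<close>)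
  have S_cont': "continuous_on UNIV (\<lambda>y. S (fst y) (snd y))"
    by (rule uniform_limit_theorem[OF always_eventually ul])
       (auto intro!: continuous_intros e_cont[unfolded case_prod_unfold])
  then show S_cont: "continuous_on torus (\<lambda>(\<theta>, \<gamma>). S \<theta> \<gamma>)"
    by (auto simp: case_prod_unfold intro: continuous_on_subset)
  define B where "B = infsum (\<lambda>x. norm (b x)) UNIV"
  have S_bound: "norm (S \<theta> \<gamma>) \<le> B" for \<theta> \<gamma>
  proof -
    have "((\<lambda>x. norm (b x * e x \<theta> \<gamma>)) has_sum B) UNIV"
      using b by (simp add: norm_mult e_norm B_def)
    then show ?thesis
      using norm_has_sum_bound[of "\<lambda>x. b x * e x \<theta> \<gamma>" UNIV B "S \<theta> \<gamma>"] S by (simp add: e_def)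
  qed
  have orth: "torus_integral (\<lambda>\<theta> \<gamma>. e x \<theta> \<gamma> * cnj (e y \<theta> \<gamma>)) = (if x = y then 4 * pi\<^sup>2 else 0)" for x y
  proof -
    have *: "e x \<theta> \<gamma> * cnj (e y \<theta> \<gamma>) = cis (of_int (l x - l y) * \<gamma>) * cis (of_int (k x - k y) * \<theta>)" for \<theta> \<gamma>
      by (simp add: e_def cis_cnj cis_mult algebra_simps)
    have "torus_integral (\<lambda>\<theta> \<gamma>. e x \<theta> \<gamma> * cnj (e y \<theta> \<gamma>)) =
      integral {0..2*pi} (\<lambda>\<gamma>. cis (of_int (l x - l y) * \<gamma>)) * integral {0..2*pi} (\<lambda>\<theta>. cis (of_int (k x - k y) * \<theta>))"
      unfolding torus_integral_def * by (simp only: integral_mult_left integral_mult_right)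
    also have "\<dots> = (if l x - l y = 0 then 2 * pi else 0) * (if k x - k y = 0 then 2 * pi else 0)"
      unfolding integral_cis_int by simp
    also have "\<dots> = (if x = y then 4 * pi\<^sup>2 else 0)"
      using injD[OF inj, of x y] by (auto simp: power2_eq_square)
    finally show ?thesis .
  qed
  have coeff: "torus_integral (\<lambda>\<theta> \<gamma>. e x \<theta> \<gamma> * cnj (S \<theta> \<gamma>)) = 4 * pi\<^sup>2 * cnj (b x)" for x
  proof -
    have "((\<lambda>y. torus_integral (\<lambda>\<theta> \<gamma>. e x \<theta> \<gamma> * cnj (b y * e y \<theta> \<gamma>))) has_sum
           torus_integral (\<lambda>\<theta> \<gamma>. e x \<theta> \<gamma> * cnj (S \<theta> \<gamma>))) UNIV"
    proof (rule torus_integral_has_sum[OF _ _ b])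
      show "continuous_on torus (\<lambda>(\<theta>, \<gamma>). e x \<theta> \<gamma> * cnj (b y * e y \<theta> \<gamma>))" for y
        using e_cont[of torus x] e_cont[of torus y] unfolding case_prod_unfold by (intro continuous_intros)
      show "((\<lambda>y. e x \<theta> \<gamma> * cnj (b y * e y \<theta> \<gamma>)) has_sum e x \<theta> \<gamma> * cnj (S \<theta> \<gamma>)) UNIV" for \<theta> \<gamma>
        by (rule has_sum_cmult_right) (simp only: has_sum_cnj_iff, simp add: e_def S)
    qed (simp add: norm_mult e_norm)
    moreover have "torus_integral (\<lambda>\<theta> \<gamma>. e x \<theta> \<gamma> * cnj (b y * e y \<theta> \<gamma>)) =
        cnj (b y) * torus_integral (\<lambda>\<theta> \<gamma>. e x \<theta> \<gamma> * cnj (e y \<theta> \<gamma>))" for y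
      unfolding torus_integral_def by (simp add: mult.left_commute)
    ultimately have "((\<lambda>y. cnj (b y) * (if x = y then 4 * pi\<^sup>2 else 0)) has_sum
           torus_integral (\<lambda>\<theta> \<gamma>. e x \<theta> \<gamma> * cnj (S \<theta> \<gamma>))) UNIV"
      unfolding orth by simp
    moreover have "((\<lambda>y. cnj (b y) * (if x = y then 4 * pi\<^sup>2 else 0)) has_sum (4 * pi\<^sup>2 * cnj (b x))) UNIV"
      by (rule has_sum_finite_neutralI[of "{x}"]) auto
    ultimately show ?thesis by (rule has_sum_unique)
  qed
  have "((\<lambda>x. torus_integral (\<lambda>\<theta> \<gamma>. b x * e x \<theta> \<gamma> * cnj (S \<theta> \<gamma>))) has_sum
           torus_integral (\<lambda>\<theta> \<gamma>. S \<theta> \<gamma> * cnj (S \<theta> \<gamma>))) UNIV"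
  proof (rule torus_integral_has_sum)
    show "continuous_on torus (\<lambda>(\<theta>, \<gamma>). b x * e x \<theta> \<gamma> * cnj (S \<theta> \<gamma>))" for x
      using e_cont[of torus x] S_cont unfolding case_prod_unfold by (intro continuous_intros)
    show "norm (b x * e x \<theta> \<gamma> * cnj (S \<theta> \<gamma>)) \<le> norm (b x) * B" for x \<theta> \<gamma>
      using S_bound[of \<theta> \<gamma>] by (simp add: norm_mult e_norm mult_left_mono)
    show "(\<lambda>x. norm (b x) * B) summable_on UNIV"
      using b by (rule summable_on_cmult_left)
    show "((\<lambda>x. b x * e x \<theta> \<gamma> * cnj (S \<theta> \<gamma>)) has_sum S \<theta> \<gamma> * cnj (S \<theta> \<gamma>)) UNIV" for \<theta> \<gamma>
      by (rule has_sum_cmult_left) (simp add: e_def S)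
  qed
  moreover have "torus_integral (\<lambda>\<theta> \<gamma>. b x * e x \<theta> \<gamma> * cnj (S \<theta> \<gamma>)) = 4 * pi\<^sup>2 * (norm (b x))\<^sup>2" for x
  proof -
    have "torus_integral (\<lambda>\<theta> \<gamma>. b x * e x \<theta> \<gamma> * cnj (S \<theta> \<gamma>)) = b x * torus_integral (\<lambda>\<theta> \<gamma>. e x \<theta> \<gamma> * cnj (S \<theta> \<gamma>))"
      unfolding torus_integral_def by (simp add: mult.assoc)
    then show ?thesis unfolding coeff by (simp add: complex_norm_square mult_ac del: of_real_power)
  qed
  ultimately have "((\<lambda>x. of_real (4 * pi\<^sup>2 * (norm (b x))\<^sup>2)) has_sum
      torus_integral (\<lambda>\<theta> \<gamma>. S \<theta> \<gamma> * cnj (S \<theta> \<gamma>))) UNIV" by simp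
  moreover have "torus_integral (\<lambda>\<theta> \<gamma>. S \<theta> \<gamma> * cnj (S \<theta> \<gamma>)) =
     of_real (integral {0..2*pi} (\<lambda>\<gamma>. integral {0..2*pi} (\<lambda>\<theta>. (norm (S \<theta> \<gamma>))\<^sup>2)))"
  proof -
    have c: "continuous_on torus (\<lambda>(\<theta>, \<gamma>). (norm (S \<theta> \<gamma>))\<^sup>2)"
      using S_cont unfolding case_prod_unfold by (intro continuous_intros)
    have "torus_integral (\<lambda>\<theta> \<gamma>. S \<theta> \<gamma> * cnj (S \<theta> \<gamma>)) =
        integral {0..2*pi} (\<lambda>\<gamma>. of_real (integral {0..2*pi} (\<lambda>\<theta>. (norm (S \<theta> \<gamma>))\<^sup>2)))"
      unfolding torus_integral_def complex_norm_square[symmetric]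
      by (intro integral_cong integral_complex_of_real_continuous continuous_on_slice[OF c])
    also have "\<dots> = of_real (integral {0..2*pi} (\<lambda>\<gamma>. integral {0..2*pi} (\<lambda>\<theta>. (norm (S \<theta> \<gamma>))\<^sup>2)))"
      by (intro integral_complex_of_real_continuous continuous_on_inner_integral c)
    finally show ?thesis .
  qed
  ultimately have "((\<lambda>x. 4 * pi\<^sup>2 * (norm (b x))\<^sup>2) has_sum
     integral {0..2*pi} (\<lambda>\<gamma>. integral {0..2*pi} (\<lambda>\<theta>. (norm (S \<theta> \<gamma>))\<^sup>2))) UNIV"
    by (simp only: has_sum_of_real_iff)
  from has_sum_cmult_right[OF this, of "1 / (4 * pi\<^sup>2)"]
  show "((\<lambda>x. (norm (b x))\<^sup>2) has_sum (integral {0..2*pi} (\<lambda>\<gamma>. integral {0..2*pi} (\<lambda>\<theta>. (norm (S \<theta> \<gamma>))\<^sup>2)) / (4*pi\<^sup>2))) UNIV"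
    by simp
qed

section \<open>Expansions in the orthonormal basis\<close>

text \<open>Unconditional summation over pairs of indices is used, so that the order of summation never
  matters and the two index directions can be treated one after the other.\<close>

definition expands :: "(complex \<times> complex \<Rightarrow> complex) \<Rightarrow> (nat \<times> nat \<Rightarrow> complex) \<Rightarrow> bool" where
  "expands f A \<longleftrightarrow> (\<forall>x. ((\<lambda>(i, j). A (i, j) * hardy_basis i j x) has_sum f x) UNIV)"

lemma expands_outside: "expands f A \<Longrightarrow> x \<notin> hartogs_triangle \<Longrightarrow> f x = 0"
  unfolding expands_def
  by (drule spec[of _ x], erule has_sum_unique) (cases x; simp add: hardy_basis_def case_prod_unfold)

lemma expandsI:
  assumes "\<And>x. x \<notin> hartogs_triangle \<Longrightarrow> f x = 0"
    and "\<And>x. x \<in> hartogs_triangle \<Longrightarrow> ((\<lambda>(i, j). A (i, j) * hardy_basis i j x) has_sum f x) UNIV"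
  shows "expands f A"
  unfolding expands_def
proof
  fix x show "((\<lambda>(i, j). A (i, j) * hardy_basis i j x) has_sum f x) UNIV"
  proof (cases "x \<in> hartogs_triangle")
    case False
    then show ?thesis using assms(1)[OF False] by (cases x) (simp add: hardy_basis_def case_prod_unfold)
  qed (rule assms(2))
qed

lemma expands_add:
  assumes "expands f A" "expands g B"
  shows "expands (\<lambda>x. f x + g x) (\<lambda>n. A n + B n)"
  unfolding expands_def
proof
  fix x
  have "((\<lambda>(i, j). A (i, j) * hardy_basis i j x) has_sum f x) UNIV"
       "((\<lambda>(i, j). B (i, j) * hardy_basis i j x) has_sum g x) UNIV"
    using assms unfolding expands_def by blast+
  from has_sum_add[OF this]
  show "((\<lambda>(i, j). (A (i, j) + B (i, j)) * hardy_basis i j x) has_sum f x + g x) UNIV"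
    by (simp add: case_prod_unfold distrib_right)
qed

lemma expands_scale:
  assumes "expands f A"
  shows "expands (\<lambda>x. c * f x) (\<lambda>n. c * A n)"
  unfolding expands_def
proof
  fix x
  have "((\<lambda>(i, j). A (i, j) * hardy_basis i j x) has_sum f x) UNIV"
    using assms unfolding expands_def by blast
  from has_sum_cmult_right[OF this, of c]
  show "((\<lambda>(i, j). c * A (i, j) * hardy_basis i j x) has_sum c * f x) UNIV"
    by (simp add: case_prod_unfold mult.assoc)
qed

lemma expands_basis: "expands (hardy_basis i j) (\<lambda>n. if n = (i, j) then 1 else 0)"
  unfolding expands_def
  by (intro allI has_sum_finite_neutralI[of "{(i, j)}"]) (auto split: if_splits)

lemma torus_point_mem:
  assumes "0 < s" "s < 1" "0 < t" "t < 1"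
  shows "(of_real (s * t) * cis \<theta>, of_real t * cis \<gamma>) \<in> hartogs_triangle"
  using assms by (simp add: hartogs_triangle_def norm_mult)

text \<open>On the torus the basis functions are, up to a positive factor, the characters
  \<open>i * \<theta> + (j - i - 1) * \<gamma>\<close>. Distinct index pairs give distinct characters, which is what
  Parseval's identity asks for.\<close>

lemma hardy_basis_torus:
  assumes "0 < s" "s < 1" "0 < t" "t < 1"
  shows "hardy_basis i j (of_real (s * t) * cis \<theta>, of_real t * cis \<gamma>) =
    of_real (s ^ i * t ^ j / t) * (cis (of_int (int i) * \<theta>) * cis (of_int (int j - int i - 1) * \<gamma>))"
proof -
  have *: "(of_real (s * t) * cis \<theta>) / (of_real t * cis \<gamma>) = of_real s * cis (\<theta> - \<gamma>)"
    using assms by (simp add: cis_divide[symmetric])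
  have "hardy_basis i j (of_real (s * t) * cis \<theta>, of_real t * cis \<gamma>) =
     1 / (of_real t * cis \<gamma>) * (of_real s * cis (\<theta> - \<gamma>)) ^ i * (of_real t * cis \<gamma>) ^ j"
    using torus_point_mem[OF assms, of \<theta> \<gamma>] unfolding hardy_basis_def split_conv * by simp
  also have "\<dots> = of_real (s ^ i * t ^ j / t) * (inverse (cis \<gamma>) * cis (\<theta> - \<gamma>) ^ i * cis \<gamma> ^ j)"
    by (simp add: power_mult_distrib divide_inverse mult_ac)
  also have "inverse (cis \<gamma>) * cis (\<theta> - \<gamma>) ^ i * cis \<gamma> ^ j =
     cis (of_int (int i) * \<theta>) * cis (of_int (int j - int i - 1) * \<gamma>)"
    by (simp add: cis_inverse Complex.DeMoivre cis_mult algebra_simps)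
  finally show ?thesis .
qed

lemma hardy_mean_expands:
  assumes f: "expands f A" and st: "0 < s" "s < 1" "0 < t" "t < 1"
  shows "((\<lambda>(i, j). (norm (A (i, j)))\<^sup>2 * (s * s ^ (2*i) * t ^ (2*j))) has_sum hardy_mean f s t) UNIV"
proof -
  define b where "b = (\<lambda>(i, j). A (i, j) * of_real (s ^ i * t ^ j / t))"
  define S where "S = (\<lambda>\<theta> \<gamma>. f (of_real (s * t) * cis \<theta>, of_real t * cis \<gamma>))"
  have S: "((\<lambda>x. b x * (cis (of_int (int (fst x)) * \<theta>) * cis (of_int (int (snd x) - int (fst x) - 1) * \<gamma>))) has_sum S \<theta> \<gamma>) UNIV" for \<theta> \<gamma>
  proof -
    have "((\<lambda>(i, j). A (i, j) * hardy_basis i j (of_real (s * t) * cis \<theta>, of_real t * cis \<gamma>)) has_sum S \<theta> \<gamma>) UNIV"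
      using f unfolding expands_def S_def by blast
    then show ?thesis
      unfolding hardy_basis_torus[OF st] b_def by (simp add: case_prod_unfold mult.assoc)
  qed
  have b: "(\<lambda>x. norm (b x)) summable_on UNIV"
    using has_sum_imp_summable[OF S[of 0 0]] by (simp add: summable_on_iff_abs_summable_on_complex)
  have inj: "inj (\<lambda>x::nat \<times> nat. (int (fst x), int (snd x) - int (fst x) - 1))"
    by (auto simp: inj_def)
  note P = torus_parseval[OF inj b S]
  have "hardy_mean f s t = (s * t\<^sup>2) * (integral {0..2*pi} (\<lambda>\<gamma>. integral {0..2*pi} (\<lambda>\<theta>. (norm (S \<theta> \<gamma>))\<^sup>2)) / (4*pi\<^sup>2))"
    unfolding hardy_mean_def S_def by simp
  moreover have *: "(s * t\<^sup>2) * (norm (b (i, j)))\<^sup>2 = (norm (A (i, j)))\<^sup>2 * (s * s ^ (2*i) * t ^ (2*j))" for i j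
    using st by (simp add: b_def norm_mult norm_divide norm_power power_mult_distrib power_divide power_mult [symmetric] mult_ac)
  have "(\<lambda>(i, j). (norm (A (i, j)))\<^sup>2 * (s * s ^ (2*i) * t ^ (2*j))) = (\<lambda>x. (s * t\<^sup>2) * (norm (b x))\<^sup>2)"
  proof
    fix x show "(case x of (i, j) \<Rightarrow> (norm (A (i, j)))\<^sup>2 * (s * s ^ (2*i) * t ^ (2*j))) = (s * t\<^sup>2) * (norm (b x))\<^sup>2"
      by (cases x) (simp only: split_conv *)
  qed
  ultimately show ?thesis
    using has_sum_cmult_right[OF P(1), of "s * t\<^sup>2"] by simp
qed

definition norm2 :: "(nat \<times> nat \<Rightarrow> complex) \<Rightarrow> real" where
  "norm2 A = infsum (\<lambda>n. (norm (A n))\<^sup>2) UNIV"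

abbreviation square_summable :: "(nat \<times> nat \<Rightarrow> complex) \<Rightarrow> bool" where
  "square_summable A \<equiv> (\<lambda>n. (norm (A n))\<^sup>2) summable_on UNIV"

abbreviation mean_bounded :: "(complex \<times> complex \<Rightarrow> complex) \<Rightarrow> bool" where
  "mean_bounded f \<equiv> bdd_above ((\<lambda>(s, t). hardy_mean f s t) ` ({0<..<1} \<times> {0<..<1}))"

lemma hardy_mean_le_norm2:
  assumes f: "expands f A" and st: "0 < s" "s < 1" "0 < t" "t < 1" and A: "square_summable A"
  shows "hardy_mean f s t \<le> norm2 A"
proof (rule has_sum_mono[OF hardy_mean_expands[OF f st]])
  show "((\<lambda>n. (norm (A n))\<^sup>2) has_sum norm2 A) UNIV" using A by (simp add: norm2_def)
  fix x :: "nat \<times> nat"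
  obtain i j where x: "x = (i, j)" by (cases x)
  have "s * s ^ (2*i) * t ^ (2*j) \<le> 1 * 1 * 1"
    using st by (intro mult_mono power_le_one) auto
  then show "(case x of (i, j) \<Rightarrow> (norm (A (i, j)))\<^sup>2 * (s * s ^ (2*i) * t ^ (2*j))) \<le> (norm (A x))\<^sup>2"
    unfolding x by (simp add: mult_left_le)
qed

text \<open>Letting \<open>s = t\<close> tend to \<open>1\<close> in a finite partial sum of Parseval's identity removes the weights.\<close>

lemma mean_bounded_imp_square_summable:
  assumes f: "expands f A" and M: "\<And>s. 0 < s \<Longrightarrow> s < 1 \<Longrightarrow> hardy_mean f s s \<le> M"
  shows "square_summable A" "norm2 A \<le> M"
proof -
  have fin: "(\<Sum>n\<in>F. (norm (A n))\<^sup>2) \<le> M" if F: "finite F" for F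
  proof (rule tendsto_upperbound)
    show "((\<lambda>s. \<Sum>(i, j)\<in>F. (norm (A (i, j)))\<^sup>2 * (s * s ^ (2*i) * s ^ (2*j))) \<longlongrightarrow> (\<Sum>n\<in>F. (norm (A n))\<^sup>2)) (at_left (1::real))"
      by (auto simp: case_prod_unfold intro!: tendsto_eq_intros)
    have "\<forall>\<^sub>F s in at_left (1::real). s \<in> {0<..<1}"
      by (rule eventually_at_leftI[of 0]) auto
    then show "\<forall>\<^sub>F s in at_left (1::real). (\<Sum>(i, j)\<in>F. (norm (A (i, j)))\<^sup>2 * (s * s ^ (2*i) * s ^ (2*j))) \<le> M"
    proof eventually_elim
      case (elim s)
      then have s: "0 < s" "s < 1" by auto
      have "(\<Sum>(i, j)\<in>F. (norm (A (i, j)))\<^sup>2 * (s * s ^ (2*i) * s ^ (2*j))) \<le> hardy_mean f s s"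
        by (rule finite_sum_le_has_sum[OF hardy_mean_expands[OF f s s] F]) (use s in auto)
      then show ?case using M[OF s] by simp
    qed
  qed simp
  show 1: "square_summable A"
    by (rule nonneg_bdd_above_summable_on) (auto intro!: bdd_aboveI2 fin)
  show "norm2 A \<le> M"
    unfolding norm2_def by (rule infsum_le_finite_sums[OF 1]) (rule fin)
qed

lemma mean_bounded_iff:
  assumes f: "expands f A"
  shows "mean_bounded f \<longleftrightarrow> square_summable A"
proof
  assume "mean_bounded f"
  then obtain M where "\<forall>s\<in>{0<..<1}. \<forall>t\<in>{0<..<1}. hardy_mean f s t \<le> M"
    by (auto simp: bdd_above_def)
  then show "square_summable A" by (intro mean_bounded_imp_square_summable(1)[OF f, of M]) auto
next
  assume "square_summable A"
  then show "mean_bounded f"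
    by (auto intro!: bdd_aboveI2 hardy_mean_le_norm2[OF f])
qed

lemma hardy_norm_expands:
  assumes f: "expands f A" and A: "square_summable A"
  shows "(hardy_norm f)\<^sup>2 = norm2 A"
proof -
  have "(SUP (s, t)\<in>{0<..<1} \<times> {0<..<1}. hardy_mean f s t) = norm2 A"
  proof (rule antisym)
    show "(SUP (s, t)\<in>{0<..<1} \<times> {0<..<1}. hardy_mean f s t) \<le> norm2 A"
      by (rule cSUP_least) (auto intro!: exI[of _ "1/2"] hardy_mean_le_norm2[OF f _ _ _ _ A])
    have "mean_bounded f" using A mean_bounded_iff[OF f] by simp
    then have "hardy_mean f s s \<le> (SUP (s, t)\<in>{0<..<1} \<times> {0<..<1}. hardy_mean f s t)" if "0 < s" "s < 1" for s
      using cSUP_upper[of "(s, s)" "{0<..<1} \<times> {0<..<1}" "\<lambda>(s, t). hardy_mean f s t"] that by auto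
    then show "norm2 A \<le> (SUP (s, t)\<in>{0<..<1} \<times> {0<..<1}. hardy_mean f s t)"
      by (rule mean_bounded_imp_square_summable(2)[OF f])
  qed
  moreover have "norm2 A \<ge> 0" unfolding norm2_def by (rule infsum_nonneg) auto
  ultimately show ?thesis unfolding hardy_norm_def by simp
qed

text \<open>The difference of two expansions represents zero, and Parseval's identity turns the vanishing
  mean into the vanishing of every coefficient.\<close>

lemma expands_unique:
  assumes "expands f A" "expands f B"
  shows "A = B"
proof -
  have "expands (\<lambda>x. f x + (-1) * f x) (\<lambda>n. A n + (-1) * B n)"
    by (intro expands_add expands_scale assms)
  then have z: "expands (\<lambda>x. 0) (\<lambda>n. A n - B n)" by simp
  have "hardy_mean (\<lambda>x. 0) s t = 0" for s t by (simp add: hardy_mean_def)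
  then have "((\<lambda>(i, j). (norm (A (i, j) - B (i, j)))\<^sup>2 * (1/2 * (1/2) ^ (2*i) * (1/2) ^ (2*j))) has_sum 0) UNIV"
    using hardy_mean_expands[OF z, of "1/2" "1/2"] by simp
  then have "(case n of (i, j) \<Rightarrow> (norm (A (i, j) - B (i, j)))\<^sup>2 * (1/2 * (1/2) ^ (2*i) * (1/2::real) ^ (2*j))) = 0" for n
    by (rule nonneg_has_sum_le_0D) auto
  then have "norm (A n - B n) = 0" for n by (cases n) (auto dest: meta_spec[of _ n])
  then show ?thesis by (auto simp: fun_eq_iff)
qed

section \<open>Removing the puncture under bounded circle means\<close>

text \<open>A bound in terms of the \<open>L\<^sup>1\<close> mean of \<open>g\<close> over the circle: only such means are controlled in a
  Hardy space, not the supremum of \<open>g\<close>.\<close>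

lemma circle_integral_bound:
  assumes I: "((\<lambda>\<zeta>. g \<zeta> * m \<zeta>) has_contour_integral I) (circlepath 0 t)"
    and t: "0 < t" and g: "continuous_on (sphere 0 t) g"
    and m: "\<And>\<zeta>. norm \<zeta> = t \<Longrightarrow> norm (m \<zeta>) \<le> B"
  shows "norm I \<le> B * t * integral {0..2*pi} (\<lambda>x. norm (g (of_real t * cis x)))"
proof -
  have cont: "continuous_on {0..2*pi} (\<lambda>x. norm (g (of_real t * cis x)))"
    by (intro continuous_on_norm continuous_on_compose2[OF g] continuous_intros)
       (use t in \<open>auto simp: norm_mult\<close>)
  have *: "((\<lambda>x. g (0 + of_real t * cis x) * m (0 + of_real t * cis x) * of_real t * \<i> * cis x) has_integral I) {0..2*pi}"
    using I unfolding circlepath_def by (subst (asm) has_contour_integral_part_circlepath_iff) auto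
  have "norm (integral {0..2*pi} (\<lambda>x. g (0 + of_real t * cis x) * m (0 + of_real t * cis x) * of_real t * \<i> * cis x))
     \<le> integral {0..2*pi} (\<lambda>x. B * t * norm (g (of_real t * cis x)))"
  proof (rule integral_norm_bound_integral)
    show "(\<lambda>x. B * t * norm (g (of_real t * cis x))) integrable_on {0..2*pi}"
      by (intro integrable_continuous_real continuous_intros cont)
    fix x
    have "norm (m (of_real t * cis x)) \<le> B" by (rule m) (use t in \<open>simp add: norm_mult\<close>)
    then have "norm (g (of_real t * cis x)) * t * norm (m (of_real t * cis x)) \<le> norm (g (of_real t * cis x)) * t * B"
      using t by (intro mult_left_mono) auto
    then show "norm (g (0 + of_real t * cis x) * m (0 + of_real t * cis x) * of_real t * \<i> * cis x) \<le> B * t * norm (g (of_real t * cis x))"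
      using t by (simp add: norm_mult mult_ac)
  qed (use * in blast)
  also have "integral {0..2*pi} (\<lambda>x. g (0 + of_real t * cis x) * m (0 + of_real t * cis x) * of_real t * \<i> * cis x) = I"
    by (rule integral_unique[OF *])
  finally show ?thesis by simp
qed

text \<open>Cauchy's formula in an annulus has a second contribution, from a small circle of radius \<open>r\<close>
  around the puncture. Up to the factor \<open>2 * pi * \<i>\<close> it is the residue at \<open>0\<close> of the difference quotient of \<open>g\<close>, so it does
  not depend on \<open>r\<close>, and it is \<open>O(r)\<close> since the \<open>L\<^sup>1\<close> means of \<open>g\<close> stay bounded. Hence it vanishes.\<close>

lemma cauchy_formula_punctured_disc:
  assumes holo: "g holomorphic_on ball 0 1 - {0}"
    and C: "\<And>t. 0 < t \<Longrightarrow> t < 1 \<Longrightarrow> integral {0..2*pi} (\<lambda>x. norm (g (of_real t * cis x))) \<le> C"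
    and v: "0 < norm v" "norm v < \<rho>" and \<rho>: "\<rho> < 1"
  shows "((\<lambda>\<zeta>. g \<zeta> * (1 / (\<zeta> - v))) has_contour_integral (2 * pi * \<i> * g v)) (circlepath 0 \<rho>)"
proof -
  \<comment> \<open>The difference quotient is holomorphic at \<open>v\<close>, so \<open>0\<close> is its only singularity and its integral is the same over every circle.\<close>
  define k where "k = (\<lambda>\<zeta>. if \<zeta> = v then deriv g v else (g \<zeta> - g v) / (\<zeta> - v))"
  have op: "open (ball (0::complex) 1 - {0})" by auto
  have vin: "v \<in> ball 0 1 - {0}" using v \<rho> by auto
  have k: "k holomorphic_on ball 0 1 - {0}"
    unfolding k_def by (rule pole_lemma[OF holo]) (use vin op in \<open>simp add: interior_open\<close>)
  have res: "(k has_contour_integral (2 * pi * \<i> * residue k 0)) (circlepath 0 r)" if "0 < r" "r < 1" for r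
    by (rule base_residue[of "ball 0 1"]) (use that k in auto)
  have split: "((\<lambda>\<zeta>. g \<zeta> * (1 / (\<zeta> - v))) has_contour_integral (2 * pi * \<i> * residue k 0 + g v * J)) (circlepath 0 r)"
    if r: "0 < r" "r < 1" "r \<noteq> norm v" and J: "((\<lambda>\<zeta>. 1 / (\<zeta> - v)) has_contour_integral J) (circlepath 0 r)" for r J
  proof (rule has_contour_integral_eq[OF has_contour_integral_add[OF res[OF r(1,2)] has_contour_integral_lmul[OF J]]])
    fix \<zeta> assume "\<zeta> \<in> path_image (circlepath 0 r)"
    then have "\<zeta> \<noteq> v" using r by auto
    then show "k \<zeta> + g v * (1 / (\<zeta> - v)) = g \<zeta> * (1 / (\<zeta> - v))"
      by (simp add: k_def diff_divide_distrib)
  qed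
  have small: "norm (2 * pi * \<i> * residue k 0) \<le> 1 / (norm v - r) * r * C" if r: "0 < r" "r < norm v" for r
  proof -
    have C0: "integral {0..2*pi} (\<lambda>x. norm (g (of_real r * cis x))) \<le> C"
      using r v \<rho> by (intro C) auto
    have "((\<lambda>\<zeta>. 1 / (\<zeta> - v)) has_contour_integral 0) (circlepath 0 r)"
      by (rule Cauchy_theorem_convex_simple[of _ "ball 0 (norm v)"])
         (use r in \<open>auto intro!: holomorphic_intros\<close>)
    from split[OF r(1) _ _ this] have "((\<lambda>\<zeta>. g \<zeta> * (1 / (\<zeta> - v))) has_contour_integral (2 * pi * \<i> * residue k 0)) (circlepath 0 r)"
      using r v \<rho> by simp
    then have "norm (2 * pi * \<i> * residue k 0) \<le> 1 / (norm v - r) * r * integral {0..2*pi} (\<lambda>x. norm (g (of_real r * cis x)))"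
    proof (rule circle_integral_bound)
      show "continuous_on (sphere 0 r) g"
        by (rule continuous_on_subset[OF holomorphic_on_imp_continuous_on[OF holo]]) (use r v \<rho> in auto)
      fix \<zeta> :: complex assume "norm \<zeta> = r"
      then have "norm v - r \<le> norm (\<zeta> - v)"
        using norm_triangle_ineq2[of v \<zeta>] by (simp add: norm_minus_commute)
      then show "norm (1 / (\<zeta> - v)) \<le> 1 / (norm v - r)"
        using r by (simp add: norm_divide frac_le)
    qed fact
    also have "\<dots> \<le> 1 / (norm v - r) * r * C"
      using r C0 by (intro mult_left_mono) auto
    finally show ?thesis .
  qed
  have "norm (2 * pi * \<i> * residue k 0) \<le> 0"
  proof (rule tendsto_lowerbound)
    show "((\<lambda>r. 1 / (norm v - r) * r * C) \<longlongrightarrow> 0) (at_right 0)"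
      using v by (auto intro!: tendsto_eq_intros)
    show "\<forall>\<^sub>F r in at_right 0. norm (2 * pi * \<i> * residue k 0) \<le> 1 / (norm v - r) * r * C"
      by (rule eventually_at_rightI[of 0 "norm v"]) (use v small in auto)
  qed simp
  then have "residue k 0 = 0" by simp
  moreover have "((\<lambda>\<zeta>. 1 / (\<zeta> - v)) has_contour_integral (2 * pi * \<i> * 1)) (circlepath 0 \<rho>)"
    using Cauchy_integral_circlepath_simple[of "\<lambda>_. 1" 0 \<rho> v] v by simp
  ultimately show ?thesis
    using split[of \<rho> "2 * pi * \<i> * 1"] v \<rho> by (simp add: mult_ac)
qed

text \<open>By the Cauchy formula across the puncture \<open>g\<close> is bounded near \<open>0\<close>, so Riemann's theorem applies.
  The coefficient estimate is Cauchy's, again with \<open>L\<^sup>1\<close> means in place of suprema.\<close>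

lemma removable_power_series:
  assumes holo: "g holomorphic_on ball 0 1 - {0}"
    and C: "\<And>t. 0 < t \<Longrightarrow> t < 1 \<Longrightarrow> integral {0..2*pi} (\<lambda>x. norm (g (of_real t * cis x))) \<le> C"
  obtains a where "\<And>v. 0 < norm v \<Longrightarrow> norm v < 1 \<Longrightarrow> (\<lambda>j. a j * v ^ j) sums g v"
    and "\<And>j t. 0 < t \<Longrightarrow> t < 1 \<Longrightarrow>
      2 * pi * (norm (a j) * t ^ j) \<le> integral {0..2*pi} (\<lambda>x. norm (g (of_real t * cis x)))"
proof -
  have gcont: "continuous_on (sphere 0 t) g" if "0 < t" "t < 1" for t
    by (rule continuous_on_subset[OF holomorphic_on_imp_continuous_on[OF holo]]) (use that in auto)
  have bound: "norm (g v) \<le> C / pi" if v: "0 < norm v" "norm v < 1/4" for v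
  proof -
    \<comment> \<open>On the circle of radius \<open>1/2\<close> the distance to \<open>v\<close> is at least \<open>1/4\<close>.\<close>
    have "norm (2 * pi * \<i> * g v) \<le> 4 * (1/2) * integral {0..2*pi} (\<lambda>x. norm (g (of_real (1/2) * cis x)))"
    proof (rule circle_integral_bound)
      show "((\<lambda>\<zeta>. g \<zeta> * (1 / (\<zeta> - v))) has_contour_integral (2 * pi * \<i> * g v)) (circlepath 0 (1/2))"
        by (rule cauchy_formula_punctured_disc[OF holo C]) (use v in auto)
      fix \<zeta> :: complex assume "norm \<zeta> = 1/2"
      then have "1/4 \<le> norm (\<zeta> - v)"
        using norm_triangle_ineq2[of \<zeta> v] v by simp
      then have "1 / norm (\<zeta> - v) \<le> 1 / (1/4)" by (intro frac_le) auto
      then show "norm (1 / (\<zeta> - v)) \<le> 4" by (simp add: norm_divide)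
    qed (simp_all add: gcont)
    also have "\<dots> \<le> 2 * C" using C[of "1/2"] by simp
    finally have "2 * pi * norm (g v) \<le> 2 * C" by (simp add: norm_mult)
    then show ?thesis by (simp add: pos_le_divide_eq mult.commute)
  qed
  have "\<forall>\<^sub>F v in at 0. norm (g v) \<le> C / pi"
    unfolding eventually_at by (rule exI[of _ "1/4"]) (simp add: bound)
  then have "\<exists>G. G holomorphic_on ball 0 1 \<and> (\<forall>v\<in>ball 0 1 - {0}. G v = g v)"
    by (subst holomorphic_on_extend_bounded[OF holo]) auto
  then obtain G where G: "G holomorphic_on ball 0 1" and Gg: "\<And>v. 0 < norm v \<Longrightarrow> norm v < 1 \<Longrightarrow> G v = g v"
    by (force simp: dist_norm)
  show thesis
  proof
    fix v :: complex assume "0 < norm v" "norm v < 1"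
    then show "(\<lambda>j. (deriv ^^ j) G 0 / fact j * v ^ j) sums g v"
      using holomorphic_power_series[OF G, of v] Gg by simp
  next
    fix j and t :: real assume t: "0 < t" "t < 1"
    have "((\<lambda>u. G u / (u - 0) ^ Suc j) has_contour_integral (2 * pi * \<i> / fact j * (deriv ^^ j) G 0)) (circlepath 0 t)"
      by (rule Cauchy_has_contour_integral_higher_derivative_circlepath)
         (use t G in \<open>auto intro!: holomorphic_on_imp_continuous_on intro: holomorphic_on_subset\<close>)
    then have "((\<lambda>u. g u * (1 / u ^ Suc j)) has_contour_integral (2 * pi * \<i> / fact j * (deriv ^^ j) G 0)) (circlepath 0 t)"
      by (rule has_contour_integral_eq) (use t in \<open>auto simp: Gg\<close>)
    then have "norm (2 * pi * \<i> / fact j * (deriv ^^ j) G 0)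
       \<le> 1 / t ^ Suc j * t * integral {0..2*pi} (\<lambda>x. norm (g (of_real t * cis x)))"
      by (rule circle_integral_bound) (use t in \<open>auto simp: norm_divide norm_power norm_mult intro!: gcont\<close>)
    then show "2 * pi * (norm ((deriv ^^ j) G 0 / fact j) * t ^ j) \<le> integral {0..2*pi} (\<lambda>x. norm (g (of_real t * cis x)))"
      using t by (simp add: norm_mult norm_divide field_simps)
  qed
qed

section \<open>Existence of the expansion\<close>

text \<open>Morera's theorem: the integral over a triangle can be exchanged with the integral over the
  circle, and the inner integrals vanish by Cauchy's theorem.\<close>

lemma holomorphic_circle_integral:
  assumes cont: "continuous_on (sphere 0 \<rho> \<times> U) (\<lambda>(z, w). F z w)"
    and holo: "\<And>z. norm z = \<rho> \<Longrightarrow> (\<lambda>w. F z w) holomorphic_on U"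
    and U: "open U" and \<rho>: "0 < \<rho>"
  shows "(\<lambda>w. contour_integral (circlepath 0 \<rho>) (\<lambda>z. F z w)) holomorphic_on U"
proof -
  have c1: "continuous_on U (\<lambda>w. contour_integral (circlepath 0 \<rho>) (\<lambda>z. F z w))"
  proof -
    have "continuous_on (U \<times> cbox 0 (2*pi)) (\<lambda>x. (\<lambda>(z, w). F z w) (of_real \<rho> * cis (snd x), fst x) * of_real \<rho> * \<i> * cis (snd x))"
      by (intro continuous_intros continuous_on_compose2[OF cont])
         (use \<rho> in \<open>auto intro!: continuous_intros simp: norm_mult\<close>)
    then have "continuous_on (U \<times> cbox 0 (2*pi)) (\<lambda>(w, x). F (0 + of_real \<rho> * cis x) w * of_real \<rho> * \<i> * cis x)"
      by (simp add: case_prod_unfold)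
    from integral_continuous_on_param[OF this] show ?thesis
      unfolding circlepath_def by (subst contour_integral_part_circlepath_eq) auto
  qed
  have c2: "continuous_on (sphere 0 \<rho>) (\<lambda>z. contour_integral (linepath a b) (F z))" if ab: "closed_segment a b \<subseteq> U" for a b
  proof -
    have lp: "linepath a b x \<in> U" if "x \<in> {0..1}" for x
      using ab that by (auto simp: linepath_in_path)
    have "continuous_on (sphere 0 \<rho> \<times> cbox 0 (1::real)) (\<lambda>x. linepath a b (snd x))"
      unfolding linepath_def by (intro continuous_intros)
    then have "continuous_on (sphere 0 \<rho> \<times> cbox 0 (1::real)) (\<lambda>x. (\<lambda>(z, w). F z w) (fst x, linepath a b (snd x)) * (b - a))"
      by (intro continuous_intros continuous_on_compose2[OF cont])
         (auto intro!: continuous_intros lp)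
    then have "continuous_on (sphere 0 \<rho> \<times> cbox 0 (1::real)) (\<lambda>(z, x). F z (linepath a b x) * (b - a))"
      by (simp add: case_prod_unfold)
    from integral_continuous_on_param[OF this] show ?thesis
      unfolding contour_integral_integral by simp
  qed
  have swap: "contour_integral (linepath a b) (\<lambda>w. contour_integral (circlepath 0 \<rho>) (\<lambda>z. F z w)) =
     contour_integral (circlepath 0 \<rho>) (\<lambda>z. contour_integral (linepath a b) (F z))" 
    if ab: "closed_segment a b \<subseteq> U" for a b
  proof (rule contour_integral_swap)
    have "continuous_on (closed_segment a b \<times> sphere 0 \<rho>) (\<lambda>x. (\<lambda>(z, w). F z w) (snd x, fst x))"
      by (intro continuous_intros continuous_on_compose2[OF cont])
         (use ab in \<open>auto intro!: continuous_intros\<close>)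
    then show "continuous_on (path_image (linepath a b) \<times> path_image (circlepath 0 \<rho>)) (\<lambda>(y1, y2). F y2 y1)"
      using \<rho> by (simp add: case_prod_unfold)
  qed (auto simp: vector_derivative_circlepath intro!: continuous_intros)
  have "(\<lambda>w. contour_integral (circlepath 0 \<rho>) (\<lambda>z. F z w)) analytic_on U"
  proof (rule Morera_triangle[OF c1 U], intro impI)
    fix a b c assume hull: "convex hull {a, b, c} \<subseteq> U"
    have seg: "closed_segment a b \<subseteq> U" "closed_segment b c \<subseteq> U" "closed_segment c a \<subseteq> U"
      by (rule order_trans[OF closed_segment_subset_convex_hull hull]; auto intro: hull_inc)+
    have int: "(\<lambda>z. contour_integral (linepath p q) (F z)) contour_integrable_on circlepath 0 \<rho>" 
      if "closed_segment p q \<subseteq> U" for p q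
      by (rule contour_integrable_continuous_circlepath) (use c2[OF that] \<rho> in simp)
    have "contour_integral (linepath a b) (F z) + contour_integral (linepath b c) (F z) + contour_integral (linepath c a) (F z) = 0"
      if "norm z = \<rho>" for z
    proof -
      have "F z holomorphic_on convex hull {a, b, c}"
        by (rule holomorphic_on_subset[OF holo[OF that] hull])
      then show ?thesis 
        by (intro has_chain_integral_chain_integral3 Cauchy_theorem_triangle)
    qed
    then have "contour_integral (circlepath 0 \<rho>) (\<lambda>z. contour_integral (linepath a b) (F z) + contour_integral (linepath b c) (F z) + contour_integral (linepath c a) (F z)) =
         contour_integral (circlepath 0 \<rho>) (\<lambda>z. 0)"
      by (intro contour_integral_eq) (use \<rho> in auto)
    then show "contour_integral (linepath a b) (\<lambda>w. contour_integral (circlepath 0 \<rho>) (\<lambda>z. F z w)) +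
        contour_integral (linepath b c) (\<lambda>w. contour_integral (circlepath 0 \<rho>) (\<lambda>z. F z w)) +
        contour_integral (linepath c a) (\<lambda>w. contour_integral (circlepath 0 \<rho>) (\<lambda>z. F z w)) = 0"
      unfolding swap[OF seg(1)] swap[OF seg(2)] swap[OF seg(3)]
      by (simp add: contour_integral_add contour_integrable_add int seg)
  qed
  then show ?thesis by (rule analytic_imp_holomorphic)
qed

lemma holomorphic2_on_imp_continuous_on:
  assumes "holomorphic2_on f S" shows "continuous_on S f"
  using assms unfolding holomorphic2_on_def
  by (meson continuous_at_imp_continuous_on has_derivative_continuous)

lemma holomorphic2_on_fst:
  assumes f: "holomorphic2_on f S" and U: "\<And>z. z \<in> U \<Longrightarrow> (z, w) \<in> S"
  shows "(\<lambda>z. f (z, w)) holomorphic_on U"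
proof -
  have "(\<lambda>z. f (z, w)) field_differentiable at z" if z: "z \<in> U" for z
  proof -
    obtain A B where "(f has_derivative (\<lambda>(h, k). A * h + B * k)) (at (z, w))"
      using f U[OF z] unfolding holomorphic2_on_def by blast
    then have "((\<lambda>z. f (z, w)) has_derivative (\<lambda>h. (\<lambda>(h, k). A * h + B * k) (h, 0))) (at z)"
      by (intro has_derivative_compose[where f = "\<lambda>z. (z, w)" and g = f]) (auto intro!: derivative_eq_intros)
    then have "((\<lambda>z. f (z, w)) has_derivative (\<lambda>h. A * h)) (at z)"
      by simp
    then show ?thesis
      unfolding field_differentiable_def has_field_derivative_def by blast
  qed
  then show ?thesis
    by (auto simp: holomorphic_on_def intro: field_differentiable_at_within)
qed

lemma holomorphic2_on_snd:
  assumes f: "holomorphic2_on f S" and U: "\<And>w. w \<in> U \<Longrightarrow> (z, w) \<in> S"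
  shows "(\<lambda>w. f (z, w)) holomorphic_on U"
proof -
  have "(\<lambda>w. f (z, w)) field_differentiable at w" if w: "w \<in> U" for w
  proof -
    obtain A B where "(f has_derivative (\<lambda>(h, k). A * h + B * k)) (at (z, w))"
      using f U[OF w] unfolding holomorphic2_on_def by blast
    then have "((\<lambda>w. f (z, w)) has_derivative (\<lambda>h. (\<lambda>(h, k). A * h + B * k) (0, h))) (at w)"
      by (intro has_derivative_compose[where f = "\<lambda>w. (z, w)" and g = f]) (auto intro!: derivative_eq_intros)
    then have "((\<lambda>w. f (z, w)) has_derivative (\<lambda>h. B * h)) (at w)"
      by simp
    then show ?thesis
      unfolding field_differentiable_def has_field_derivative_def by blast
  qed
  then show ?thesis
    by (auto simp: holomorphic_on_def intro: field_differentiable_at_within)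
qed

text \<open>Locally the coefficient is a Cauchy integral over a circle of fixed radius, although the radius
  has to shrink as \<open>w\<close> tends to \<open>0\<close>; the puncture can therefore not be filled at this stage.\<close>

lemma taylor_coefficient_holomorphic:
  assumes f: "holomorphic2_on f hartogs_triangle"
  shows "(\<lambda>w. (deriv ^^ i) (\<lambda>z. f (z, w)) 0) holomorphic_on ball 0 1 - {0}"
proof -
  have ex: "\<exists>U. open U \<and> w0 \<in> U \<and> (\<lambda>w. (deriv ^^ i) (\<lambda>z. f (z, w)) 0) holomorphic_on U"
    if w0: "w0 \<in> ball 0 1 - {0}" for w0
  proof -
    define \<rho> where "\<rho> = norm w0 / 2"
    define U where "U = ball 0 1 - cball (0::complex) \<rho>"
    have \<rho>: "0 < \<rho>" "\<rho> < norm w0" using w0 by (auto simp: \<rho>_def)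
    have U: "open U" unfolding U_def by (intro open_Diff) auto
    have in_H: "(z, w) \<in> hartogs_triangle" if "norm z \<le> \<rho>" "w \<in> U" for z w
      using that by (auto simp: hartogs_triangle_def U_def)
    have "(\<lambda>w. contour_integral (circlepath 0 \<rho>) (\<lambda>z. f (z, w) / (z - 0) ^ Suc i)) holomorphic_on U"
    proof (rule holomorphic_circle_integral[OF _ _ U \<rho>(1)])
      have "continuous_on (sphere 0 \<rho> \<times> U) f"
        by (rule continuous_on_subset[OF holomorphic2_on_imp_continuous_on[OF f]]) (auto intro: in_H)
      then show "continuous_on (sphere 0 \<rho> \<times> U) (\<lambda>(z, w). f (z, w) / (z - 0) ^ Suc i)"
        unfolding case_prod_unfold by (intro continuous_intros) (use \<rho> in auto)
      show "(\<lambda>w. f (z, w) / (z - 0) ^ Suc i) holomorphic_on U" if "norm z = \<rho>" for z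
        using \<rho> that by (intro holomorphic_intros holomorphic2_on_snd[OF f] in_H) auto
    qed
    then have "(\<lambda>w. fact i / (2 * pi * \<i>) * contour_integral (circlepath 0 \<rho>) (\<lambda>z. f (z, w) / (z - 0) ^ Suc i)) holomorphic_on U"
      by (intro holomorphic_intros)
    then have "(\<lambda>w. (deriv ^^ i) (\<lambda>z. f (z, w)) 0) holomorphic_on U"
    proof (rule holomorphic_transform)
      fix w assume w: "w \<in> U"
      have h: "(\<lambda>z. f (z, w)) holomorphic_on cball 0 \<rho>"
        by (rule holomorphic2_on_fst[OF f]) (use w in_H in auto)
      have "contour_integral (circlepath 0 \<rho>) (\<lambda>z. f (z, w) / (z - 0) ^ Suc i) =
          2 * pi * \<i> * (deriv ^^ i) (\<lambda>z. f (z, w)) 0 / fact i"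
        by (rule Cauchy_contour_integral_circlepath)
           (use h \<rho> in \<open>auto intro: holomorphic_on_imp_continuous_on holomorphic_on_subset\<close>)
      then show "fact i / (2 * pi * \<i>) * contour_integral (circlepath 0 \<rho>) (\<lambda>z. f (z, w) / (z - 0) ^ Suc i) =
          (deriv ^^ i) (\<lambda>z. f (z, w)) 0"
        by simp
    qed
    moreover have "w0 \<in> U" using w0 \<rho> by (auto simp: U_def)
    ultimately show ?thesis using U by blast
  qed
  show ?thesis
    unfolding holomorphic_on_def
  proof
    fix w assume "w \<in> ball 0 1 - {0::complex}"
    then obtain U where "open U" "w \<in> U" "(\<lambda>w. (deriv ^^ i) (\<lambda>z. f (z, w)) 0) holomorphic_on U"
      using ex by blast
    then show "(\<lambda>w. (deriv ^^ i) (\<lambda>z. f (z, w)) 0) field_differentiable at w within ball 0 1 - {0}"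
      using holomorphic_on_imp_differentiable_at field_differentiable_at_within by blast
  qed
qed

text \<open>The factor \<open>w ^ Suc i\<close> compensates for the shrinking disc \<open>|z| < |w|\<close>: with it the circle means
  are bounded independently of \<open>t\<close>, which makes the singularity at \<open>w = 0\<close> removable.\<close>

lemma taylor_coefficient_circle_means:
  assumes f: "holomorphic2_on f hartogs_triangle"
    and st: "0 < s" "s < 1" "0 < t" "t < 1" and M: "hardy_mean f s t \<le> M"
  shows "integral {0..2*pi} (\<lambda>\<gamma>. norm ((of_real t * cis \<gamma>) ^ Suc i * ((deriv ^^ i) (\<lambda>z. f (z, of_real t * cis \<gamma>)) 0 / fact i)))
     \<le> pi * (1 + M / s) / s ^ i"
proof -
  define S where "S = (\<lambda>\<theta> \<gamma>. f (of_real (s * t) * cis \<theta>, of_real t * cis \<gamma>))"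
  define I where "I = (\<lambda>\<gamma>. integral {0..2*pi} (\<lambda>\<theta>. norm (S \<theta> \<gamma>)))"
  have S_cont: "continuous_on torus (\<lambda>(\<theta>, \<gamma>). S \<theta> \<gamma>)"
    unfolding S_def case_prod_unfold
    by (intro continuous_on_compose2[OF holomorphic2_on_imp_continuous_on[OF f]] continuous_intros)
       (use torus_point_mem[OF st] in auto)
  have nS: "continuous_on torus (\<lambda>(\<theta>, \<gamma>). norm (S \<theta> \<gamma>))"
    using S_cont unfolding case_prod_unfold by (intro continuous_intros)
  have nS2: "continuous_on torus (\<lambda>(\<theta>, \<gamma>). (norm (S \<theta> \<gamma>))\<^sup>2)"
    using S_cont unfolding case_prod_unfold by (intro continuous_intros)
  have I_cont: "continuous_on {0..2*pi} I"
    unfolding I_def by (rule continuous_on_inner_integral[OF nS])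
  define J where "J = (\<lambda>\<gamma>. integral {0..2*pi} (\<lambda>\<theta>. (norm (S \<theta> \<gamma>))\<^sup>2))"
  have J_cont: "continuous_on {0..2*pi} J"
    unfolding J_def by (rule continuous_on_inner_integral[OF nS2])
  \<comment> \<open>\<open>2x \<le> 1 + x\<^sup>2\<close> compares the mean of \<open>t|f|\<close> with the mean square.\<close>
  have I_le: "t * I \<gamma> \<le> pi + t\<^sup>2 / 2 * J \<gamma>" if "\<gamma> \<in> {0..2*pi}" for \<gamma>
  proof -
    have i1: "(\<lambda>\<theta>. norm (S \<theta> \<gamma>)) integrable_on {0..2*pi}" "(\<lambda>\<theta>. (norm (S \<theta> \<gamma>))\<^sup>2) integrable_on {0..2*pi}"
      by (intro integrable_continuous_real continuous_on_slice[OF nS] continuous_on_slice[OF nS2] that)+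
    have "t * I \<gamma> = integral {0..2*pi} (\<lambda>\<theta>. t * norm (S \<theta> \<gamma>))" by (simp add: I_def)
    also have "\<dots> \<le> integral {0..2*pi} (\<lambda>\<theta>. 1/2 + t\<^sup>2 / 2 * (norm (S \<theta> \<gamma>))\<^sup>2)"
    proof (rule integral_le)
      fix \<theta>
      have "0 \<le> (1 - t * norm (S \<theta> \<gamma>))\<^sup>2" by simp
      then show "t * norm (S \<theta> \<gamma>) \<le> 1/2 + t\<^sup>2 / 2 * (norm (S \<theta> \<gamma>))\<^sup>2"
        by (simp add: power2_diff power_mult_distrib)
    qed (intro integrable_on_mult_right integrable_add i1 integrable_const_ivl)+
    also have "\<dots> = pi + t\<^sup>2 / 2 * J \<gamma>"
      unfolding J_def by (subst integral_add) (auto intro!: integrable_on_mult_right i1)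
    finally show ?thesis .
  qed
  have pt: "norm ((of_real t * cis \<gamma>) ^ Suc i * ((deriv ^^ i) (\<lambda>z. f (z, of_real t * cis \<gamma>)) 0 / fact i))
      \<le> (pi + t\<^sup>2 / 2 * J \<gamma>) / (2 * pi * s ^ i)" if \<gamma>: "\<gamma> \<in> {0..2*pi}" for \<gamma>
  proof -
    define w where "w = of_real t * cis \<gamma>"
    define D where "D = (deriv ^^ i) (\<lambda>z. f (z, w)) 0"
    have st': "s * t < t" "0 < s * t" using st by auto
    have nw: "norm w = t" using st by (simp add: w_def norm_mult)
    have h: "(\<lambda>z. f (z, w)) holomorphic_on cball 0 (s * t)"
    proof (rule holomorphic2_on_fst[OF f])
      fix z :: complex assume "z \<in> cball 0 (s * t)"
      then have "norm z \<le> s * t" by simp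
      then have "norm z < norm w" "norm w < 1" using st' st nw by linarith+
      then show "(z, w) \<in> hartogs_triangle" by (simp add: hartogs_triangle_def)
    qed
    have "((\<lambda>u. f (u, w) / (u - 0) ^ Suc i) has_contour_integral (2 * pi * \<i> / fact i * D)) (circlepath 0 (s * t))"
      unfolding D_def by (rule Cauchy_has_contour_integral_higher_derivative_circlepath)
         (use h st' in \<open>auto intro: holomorphic_on_imp_continuous_on holomorphic_on_subset\<close>)
    then have "((\<lambda>u. f (u, w) * (1 / u ^ Suc i)) has_contour_integral (2 * pi * \<i> / fact i * D)) (circlepath 0 (s * t))"
      by simp
    then have "norm (2 * pi * \<i> / fact i * D) \<le> 1 / (s * t) ^ Suc i * (s * t) * integral {0..2*pi} (\<lambda>x. norm (f (of_real (s * t) * cis x, w)))"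
    proof (rule circle_integral_bound)
      show "continuous_on (sphere 0 (s * t)) (\<lambda>z. f (z, w))"
        by (rule continuous_on_subset[OF holomorphic_on_imp_continuous_on[OF h]]) auto
    qed (use st' in \<open>simp_all add: norm_divide norm_power norm_mult\<close>)
    also have "integral {0..2*pi} (\<lambda>x. norm (f (of_real (s * t) * cis x, w))) = I \<gamma>"
      by (simp add: I_def S_def w_def)
    finally have "norm (2 * pi * \<i> / fact i * D) \<le> I \<gamma> / (s * t) ^ i"
      using st by (simp add: field_simps)
    then have D: "2 * pi * norm (D / fact i) \<le> I \<gamma> / (s * t) ^ i"
      by (simp add: norm_mult norm_divide)
    have "norm (w ^ Suc i * (D / fact i)) = t ^ Suc i / (2 * pi) * (2 * pi * norm (D / fact i))"
      by (simp add: norm_mult norm_power norm_divide nw)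
    also have "\<dots> \<le> t ^ Suc i / (2 * pi) * (I \<gamma> / (s * t) ^ i)"
      using st by (intro mult_left_mono D) auto
    also have "\<dots> = t * I \<gamma> / (2 * pi * s ^ i)"
      using st by (simp add: power_mult_distrib)
    also have "\<dots> \<le> (pi + t\<^sup>2 / 2 * J \<gamma>) / (2 * pi * s ^ i)"
      using st by (intro divide_right_mono I_le \<gamma>) auto
    finally show ?thesis unfolding D_def w_def .
  qed
  have "norm (integral {0..2*pi} (\<lambda>\<gamma>. norm ((of_real t * cis \<gamma>) ^ Suc i * ((deriv ^^ i) (\<lambda>z. f (z, of_real t * cis \<gamma>)) 0 / fact i))))
      \<le> integral {0..2*pi} (\<lambda>\<gamma>. (pi + t\<^sup>2 / 2 * J \<gamma>) / (2 * pi * s ^ i))"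
  proof (rule integral_norm_bound_integral)
    have "continuous_on {0..2*pi} (\<lambda>\<gamma>. (\<lambda>w. (deriv ^^ i) (\<lambda>z. f (z, w)) 0) (of_real t * cis \<gamma>))"
      by (rule continuous_on_compose2[OF holomorphic_on_imp_continuous_on[OF taylor_coefficient_holomorphic[OF f]]])
         (use st in \<open>auto intro!: continuous_intros simp: norm_mult\<close>)
    then show "(\<lambda>\<gamma>. norm ((of_real t * cis \<gamma>) ^ Suc i * ((deriv ^^ i) (\<lambda>z. f (z, of_real t * cis \<gamma>)) 0 / fact i))) integrable_on {0..2*pi}"
      by (intro integrable_continuous_real continuous_intros) auto
    show "(\<lambda>\<gamma>. (pi + t\<^sup>2 / 2 * J \<gamma>) / (2 * pi * s ^ i)) integrable_on {0..2*pi}"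
      by (intro integrable_continuous_real continuous_intros J_cont) (use st in auto)
  qed (use pt in simp)
  also have "\<dots> = (2 * pi\<^sup>2 + t\<^sup>2 / 2 * integral {0..2*pi} J) / (2 * pi * s ^ i)"
    using integrable_continuous_real[OF J_cont]
    by (subst integral_divide, subst integral_add)
       (auto intro!: integrable_on_mult_right simp: power2_eq_square)
  also have "\<dots> \<le> (pi * (1 + M / s)) / s ^ i"
  proof -
    have "hardy_mean f s t = s * t\<^sup>2 * integral {0..2*pi} J / (4 * pi\<^sup>2)"
      unfolding hardy_mean_def J_def S_def by simp
    with M have "s * (t\<^sup>2 * integral {0..2*pi} J) \<le> M * (4 * pi\<^sup>2)"
      by (simp add: pos_divide_le_eq mult_ac)
    then have "t\<^sup>2 * integral {0..2*pi} J \<le> M * (4 * pi\<^sup>2) / s"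
      using st by (simp add: pos_le_divide_eq mult_ac)
    then have "2 * pi\<^sup>2 + t\<^sup>2 / 2 * integral {0..2*pi} J \<le> (pi * (1 + M / s)) * (2 * pi)"
      using st by (simp add: algebra_simps power2_eq_square)
    then have "(2 * pi\<^sup>2 + t\<^sup>2 / 2 * integral {0..2*pi} J) / (2 * pi) \<le> pi * (1 + M / s)"
      by (subst pos_divide_le_eq) auto
    from divide_right_mono[OF this, of "s ^ i"] show ?thesis using st by simp
  qed
  finally show ?thesis by simp
qed

lemma summable_on_geometric_product:
  fixes x y :: real
  assumes "0 \<le> x" "x < 1" "0 \<le> y" "y < 1"
  shows "(\<lambda>(i::nat, j::nat). x ^ i * y ^ j) summable_on UNIV"
proof -
  have *: "((\<lambda>i::nat. z ^ i) has_sum (1 / (1 - z))) UNIV" if "0 \<le> z" "z < 1" for z :: real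
    by (rule norm_summable_imp_has_sum)
       (use that geometric_sums[of z] in \<open>auto simp: norm_power intro!: summable_geometric\<close>)
  have "((\<lambda>(i::nat, j::nat). x ^ i * y ^ j) summable_on Sigma UNIV (\<lambda>_. UNIV))"
  proof (rule summable_on_SigmaI)
    show "((\<lambda>j. case (i, j) of (i, j) \<Rightarrow> x ^ i * y ^ j) has_sum (x ^ i * (1 / (1 - y)))) UNIV" for i
      using has_sum_cmult_right[OF *[OF assms(3,4)]] by simp
    show "(\<lambda>i. x ^ i * (1 / (1 - y))) summable_on UNIV"
      using summable_on_cmult_left[OF has_sum_imp_summable[OF *[OF assms(1,2)]]] .
  qed (use assms in auto)
  then show ?thesis by simp
qed

text \<open>Expand in \<open>z\<close> for fixed \<open>w\<close>. The coefficient of \<open>z ^ i\<close>, multiplied by \<open>w ^ Suc i\<close>, extends over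
  \<open>w = 0\<close> and has a power series in \<open>w\<close>. Together these are the double series. Its absolute
  convergence follows from Cauchy estimates at larger radii.\<close>

lemma hardy_imp_expands:
  assumes "f \<in> hardy"
  obtains A where "expands f A"
proof -
  have f: "holomorphic2_on f hartogs_triangle" and f0: "\<And>x. x \<notin> hartogs_triangle \<Longrightarrow> f x = 0"
    using assms unfolding hardy_def by auto
  obtain M where M: "\<forall>s\<in>{0<..<1}. \<forall>t\<in>{0<..<1}. hardy_mean f s t \<le> M"
    using assms unfolding hardy_def bdd_above_def by auto
  then have M: "hardy_mean f s t \<le> M" if "0 < s" "s < 1" "0 < t" "t < 1" for s t
    using that by simp
  define H where "H = (\<lambda>i w. (deriv ^^ i) (\<lambda>z. f (z, w)) 0 / fact i)"
  define g where "g = (\<lambda>i w. w ^ Suc i * H i w)"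
  have g: "g i holomorphic_on ball 0 1 - {0}" for i
    unfolding g_def H_def by (intro holomorphic_intros taylor_coefficient_holomorphic f) auto
  have g_mean: "integral {0..2*pi} (\<lambda>\<gamma>. norm (g i (of_real t * cis \<gamma>))) \<le> pi * (1 + M / s) / s ^ i"
    if "0 < s" "s < 1" "0 < t" "t < 1" for s t i
    unfolding g_def H_def by (rule taylor_coefficient_circle_means[OF f that M[OF that]])
  have ex: "\<exists>a. (\<forall>v. 0 < norm v \<longrightarrow> norm v < 1 \<longrightarrow> (\<lambda>j. a j * v ^ j) sums g i v) \<and>
        (\<forall>j t. 0 < t \<longrightarrow> t < 1 \<longrightarrow> 2 * pi * (norm (a j) * t ^ j) \<le> integral {0..2*pi} (\<lambda>x. norm (g i (of_real t * cis x))))" for i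
  proof -
    have C: "integral {0..2*pi} (\<lambda>\<gamma>. norm (g i (of_real t * cis \<gamma>))) \<le> pi * (1 + M / (1/2)) / (1/2) ^ i"
      if "0 < t" "t < 1" for t
      by (rule g_mean) (use that in auto)
    show ?thesis by (rule removable_power_series[OF g C]) blast+
  qed
  obtain a where a0: "\<forall>i. (\<forall>v. 0 < norm v \<longrightarrow> norm v < 1 \<longrightarrow> (\<lambda>j. a i j * v ^ j) sums g i v) \<and>
        (\<forall>j t. 0 < t \<longrightarrow> t < 1 \<longrightarrow> 2 * pi * (norm (a i j) * t ^ j) \<le> integral {0..2*pi} (\<lambda>x. norm (g i (of_real t * cis x))))"
    using choice[OF allI[OF ex]] ..
  have a: "(\<lambda>j. a i j * v ^ j) sums g i v" if "0 < norm v" "norm v < 1" for i v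
    using a0 that by simp
  have a_le: "2 * pi * (norm (a i j) * t ^ j) \<le> integral {0..2*pi} (\<lambda>x. norm (g i (of_real t * cis x)))"
    if "0 < t" "t < 1" for i j t
    using conjunct2[OF spec[OF a0, of i]] that by blast
  have a_bound: "norm (a i j) \<le> (1 + M / s) / 2 * (1 / s) ^ i * (1 / t) ^ j" if st: "0 < s" "s < 1" "0 < t" "t < 1" for s t i j
  proof -
    have "2 * pi * (norm (a i j) * t ^ j) \<le> pi * (1 + M / s) / s ^ i"
      using a_le[of t i j] g_mean[OF st, of i] st by linarith
    then have "pi * (2 * (norm (a i j) * t ^ j)) \<le> pi * ((1 + M / s) / s ^ i)"
      by (simp only: times_divide_eq_right mult.left_commute[of pi 2] mult.assoc)
    then have "2 * (norm (a i j) * t ^ j) \<le> (1 + M / s) / s ^ i"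
      by (rule mult_le_cancel_left_pos[OF pi_gt_zero, THEN iffD1])
    then have "norm (a i j) * t ^ j \<le> (1 + M / s) / s ^ i / 2"
      by (subst pos_le_divide_eq) (simp_all only: mult.commute zero_less_numeral)
    also have "\<dots> = (1 + M / s) / 2 / s ^ i" by simp
    finally have "norm (a i j) * t ^ j \<le> (1 + M / s) / 2 / s ^ i" .
    then have "norm (a i j) \<le> (1 + M / s) / 2 / s ^ i / t ^ j"
      using st by (simp add: pos_le_divide_eq mult_ac)
    then show ?thesis by (simp add: power_divide)
  qed
  have "expands f (\<lambda>(i, j). a i j)"
  proof (rule expandsI[OF f0])
    fix x assume x: "x \<in> hartogs_triangle"
    obtain z w where xzw: "x = (z, w)" by (cases x)
    have zw: "norm z < norm w" "norm w < 1" and w0: "w \<noteq> 0" using x by (auto simp: xzw hartogs_triangle_def)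
    have u: "norm (z / w) < 1" using zw w0 by (simp add: norm_divide)
    \<comment> \<open>Cauchy estimates at radii \<open>s\<close> and \<open>t\<close> beyond the given point dominate the double series by a product of geometric series.\<close>
    obtain s where s: "norm (z / w) < s" "s < 1" using dense[OF u] by blast
    obtain t where t: "norm w < t" "t < 1" using dense[OF zw(2)] by blast
    have st0: "0 < s" "0 < t" using s t by (meson norm_ge_zero order_le_less_trans)+
    define E where "E = (\<lambda>(i, j). a i j * hardy_basis i j x)"
    have E_eq: "E (i, j) = 1 / w * (z / w) ^ i * (a i j * w ^ j)" for i j
      using x by (simp add: E_def xzw hardy_basis_def)
    have "(\<lambda>n. norm (E n)) summable_on UNIV"
    proof (rule Infinite_Sum.abs_summable_on_comparison_test')
      show "(\<lambda>n. (1 + M / s) / 2 / norm w * (case n of (i, j) \<Rightarrow> (norm (z / w) / s) ^ i * (norm w / t) ^ j)) summable_on UNIV"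
        by (intro summable_on_cmult_right summable_on_geometric_product) (use s t st0 in auto)
      fix n :: "nat \<times> nat"
      obtain i j where n: "n = (i, j)" by (cases n)
      have "norm (E (i, j)) = 1 / norm w * norm (z / w) ^ i * norm w ^ j * norm (a i j)"
        unfolding E_eq by (simp add: norm_mult norm_power norm_divide power_divide)
      also have "\<dots> \<le> 1 / norm w * norm (z / w) ^ i * norm w ^ j * ((1 + M / s) / 2 * (1 / s) ^ i * (1 / t) ^ j)"
        by (intro mult_left_mono a_bound) (use s t st0 in auto)
      also have "\<dots> = (1 + M / s) / 2 / norm w * ((norm (z / w) / s) ^ i * (norm w / t) ^ j)"
        by (simp add: power_divide mult_ac)
      finally show "norm (E n) \<le> (1 + M / s) / 2 / norm w * (case n of (i, j) \<Rightarrow> (norm (z / w) / s) ^ i * (norm w / t) ^ j)"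
        by (simp add: n)
    qed
    then have "E summable_on UNIV" by (simp add: summable_on_iff_abs_summable_on_complex)
    then have E: "E summable_on Sigma UNIV (\<lambda>_. UNIV)" by simp
    have inner: "((\<lambda>j. E (i, j)) has_sum (H i w * z ^ i)) UNIV" for i
    proof -
      have "(\<lambda>j. E (i, j)) summable_on UNIV"
        using summable_on_SigmaD1[of "\<lambda>i j. E (i, j)" UNIV "\<lambda>_. UNIV" i] E by simp
      then have h: "((\<lambda>j. E (i, j)) has_sum infsum (\<lambda>j. E (i, j)) UNIV) UNIV"
        by (rule has_sum_infsum)
      have "(\<lambda>j. E (i, j)) sums (1 / w * (z / w) ^ i * g i w)"
        unfolding E_eq by (intro sums_mult a) (use w0 zw in auto)
      also have "1 / w * (z / w) ^ i * g i w = H i w * z ^ i"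
        using w0 by (simp add: g_def power_divide)
      finally have "infsum (\<lambda>j. E (i, j)) UNIV = H i w * z ^ i"
        by (rule sums_unique2[OF has_sum_imp_sums[OF h]])
      with h show ?thesis by (simp only:)
    qed
    have "((\<lambda>i. H i w * z ^ i) has_sum infsum E UNIV) UNIV"
      by (rule has_sum_SigmaD[OF _ inner]) (use E in simp)
    then have "(\<lambda>i. H i w * z ^ i) sums infsum E UNIV" by (rule has_sum_imp_sums)
    moreover have "(\<lambda>i. H i w * z ^ i) sums f (z, w)"
    proof -
      have "(\<lambda>z. f (z, w)) holomorphic_on ball 0 (norm w)"
        by (rule holomorphic2_on_fst[OF f]) (use zw in \<open>auto simp: hartogs_triangle_def\<close>)
      from holomorphic_power_series[OF this, of z] zw show ?thesis by (simp add: H_def)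
    qed
    ultimately have "infsum E UNIV = f x" unfolding xzw by (rule sums_unique2)
    with has_sum_infsum[OF \<open>E summable_on UNIV\<close>] have "(E has_sum f x) UNIV" by (simp only:)
    then show "((\<lambda>(i, j). (case (i, j) of (i, j) \<Rightarrow> a i j) * hardy_basis i j x) has_sum f x) UNIV"
      by (simp add: E_def)
  qed
  then show thesis by (rule that)
qed

section \<open>The Hilbert space structure\<close>

lemma holomorphic2_on_const: "holomorphic2_on (\<lambda>x. c) S"
  unfolding holomorphic2_on_def
  by (intro ballI exI[of _ 0]) (simp add: case_prod_unfold)

lemma holomorphic2_on_proj: "holomorphic2_on fst S" "holomorphic2_on snd S"
proof -
  have "(fst has_derivative (\<lambda>(h, k). 1 * h + 0 * k)) (at x)"
    and "(snd has_derivative (\<lambda>(h, k). 0 * h + 1 * k)) (at x)" for x :: "complex \<times> complex"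
    using bounded_linear_imp_has_derivative[OF bounded_linear_fst]
      bounded_linear_imp_has_derivative[OF bounded_linear_snd]
    by (simp_all add: case_prod_unfold)
  then show "holomorphic2_on fst S" "holomorphic2_on snd S"
    unfolding holomorphic2_on_def by blast+
qed

lemma holomorphic2_on_add:
  assumes "holomorphic2_on f S" "holomorphic2_on g S"
  shows "holomorphic2_on (\<lambda>x. f x + g x) S"
  unfolding holomorphic2_on_def
proof
  fix x assume "x \<in> S"
  then obtain A B C D where f: "(f has_derivative (\<lambda>(h, k). A * h + B * k)) (at x)"
    and g: "(g has_derivative (\<lambda>(h, k). C * h + D * k)) (at x)"
    using assms unfolding holomorphic2_on_def by blast
  from has_derivative_add[OF f g]
  have "((\<lambda>x. f x + g x) has_derivative (\<lambda>(h, k). (A + C) * h + (B + D) * k)) (at x)"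
    by (simp add: case_prod_unfold algebra_simps)
  then show "\<exists>A B. ((\<lambda>x. f x + g x) has_derivative (\<lambda>(h, k). A * h + B * k)) (at x)" by blast
qed

lemma holomorphic2_on_mult:
  assumes "holomorphic2_on f S" "holomorphic2_on g S"
  shows "holomorphic2_on (\<lambda>x. f x * g x) S"
  unfolding holomorphic2_on_def
proof
  fix x assume "x \<in> S"
  then obtain A B C D where f: "(f has_derivative (\<lambda>(h, k). A * h + B * k)) (at x)"
    and g: "(g has_derivative (\<lambda>(h, k). C * h + D * k)) (at x)"
    using assms unfolding holomorphic2_on_def by blast
  from has_derivative_mult[OF f g]
  have "((\<lambda>x. f x * g x) has_derivative (\<lambda>(h, k). (f x * C + A * g x) * h + (f x * D + B * g x) * k)) (at x)"
    by (simp add: case_prod_unfold algebra_simps)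
  then show "\<exists>A B. ((\<lambda>x. f x * g x) has_derivative (\<lambda>(h, k). A * h + B * k)) (at x)" by blast
qed

lemma holomorphic2_on_compose:
  assumes f: "holomorphic2_on f S" and G: "\<And>x. x \<in> S \<Longrightarrow> (G has_field_derivative G' x) (at (f x))"
  shows "holomorphic2_on (\<lambda>x. G (f x)) S"
  unfolding holomorphic2_on_def
proof
  fix x assume x: "x \<in> S"
  then obtain A B where "(f has_derivative (\<lambda>(h, k). A * h + B * k)) (at x)"
    using f unfolding holomorphic2_on_def by blast
  from has_derivative_compose[OF this G[OF x, unfolded has_field_derivative_def]]
  have "((\<lambda>x. G (f x)) has_derivative (\<lambda>(h, k). (G' x * A) * h + (G' x * B) * k)) (at x)"
    by (simp add: case_prod_unfold algebra_simps)
  then show "\<exists>A B. ((\<lambda>x. G (f x)) has_derivative (\<lambda>(h, k). A * h + B * k)) (at x)" by blast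
qed

lemma holomorphic2_on_cong_open:
  assumes f: "holomorphic2_on f S" and S: "open S" and eq: "\<And>x. x \<in> S \<Longrightarrow> f x = g x"
  shows "holomorphic2_on g S"
  unfolding holomorphic2_on_def
proof
  fix x assume x: "x \<in> S"
  then obtain A B where "(f has_derivative (\<lambda>(h, k). A * h + B * k)) (at x)"
    using f unfolding holomorphic2_on_def by blast
  from has_derivative_transform_within_open[OF this S x eq]
  show "\<exists>A B. (g has_derivative (\<lambda>(h, k). A * h + B * k)) (at x)" by blast
qed

lemma open_hartogs_triangle: "open hartogs_triangle"
proof -
  have "hartogs_triangle = {x. norm (fst x) < norm (snd x)} \<inter> {x. norm (snd x) < 1}"
    by (auto simp: hartogs_triangle_def)
  moreover have "open \<dots>" by (intro open_Int open_Collect_less continuous_intros)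
  ultimately show ?thesis by (simp only:)
qed

text \<open>For functions in the Hardy space the expansion exists and is unique.\<close>

definition hardy_coeffs :: "(complex \<times> complex \<Rightarrow> complex) \<Rightarrow> nat \<times> nat \<Rightarrow> complex" where
  "hardy_coeffs f = (THE A. expands f A)"

lemma coeffs_eqI: "expands f A \<Longrightarrow> hardy_coeffs f = A"
  unfolding hardy_coeffs_def by (rule the_equality, assumption) (rule expands_unique)

lemma expands_coeffs: "f \<in> hardy \<Longrightarrow> expands f (hardy_coeffs f)"
  by (rule hardy_imp_expands[of f]) (simp_all add: coeffs_eqI)

lemma square_summable_coeffs: "f \<in> hardy \<Longrightarrow> square_summable (hardy_coeffs f)"
  using mean_bounded_iff[OF expands_coeffs[of f]] by (simp add: hardy_def)

lemma hardyI:
  assumes "holomorphic2_on f hartogs_triangle" "expands f A" "square_summable A"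
  shows "f \<in> hardy"
  using assms mean_bounded_iff[OF assms(2)] expands_outside[OF assms(2)] unfolding hardy_def by simp

lemma hardy_holomorphic: "f \<in> hardy \<Longrightarrow> holomorphic2_on f hartogs_triangle"
  by (simp add: hardy_def)

lemma square_summable_add:
  assumes "square_summable A" "square_summable B"
  shows "square_summable (\<lambda>n. A n + B n)"
proof -
  have "(\<lambda>n. norm ((norm (A n + B n))\<^sup>2)) summable_on UNIV"
  proof (rule Infinite_Sum.abs_summable_on_comparison_test')
    show "(\<lambda>n. 2 * (norm (A n))\<^sup>2 + 2 * (norm (B n))\<^sup>2) summable_on UNIV"
      by (intro summable_on_add summable_on_cmult_right assms)
    fix n
    have "(norm (A n + B n))\<^sup>2 \<le> (norm (A n) + norm (B n))\<^sup>2"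
      by (rule power_mono[OF norm_triangle_ineq]) simp
    also have "\<dots> \<le> 2 * (norm (A n))\<^sup>2 + 2 * (norm (B n))\<^sup>2"
      using zero_le_power2[of "norm (A n) - norm (B n)"] by (simp add: power2_sum power2_diff)
    finally show "norm ((norm (A n + B n))\<^sup>2) \<le> 2 * (norm (A n))\<^sup>2 + 2 * (norm (B n))\<^sup>2" by simp
  qed
  then show ?thesis by simp
qed

lemma square_summable_scale:
  assumes "square_summable A" shows "square_summable (\<lambda>n. c * A n)"
  using summable_on_cmult_right[OF assms, of "(norm c)\<^sup>2"] by (simp add: norm_mult power_mult_distrib)

lemma expands_zero: "expands (\<lambda>x. 0) (\<lambda>n. 0)"
  unfolding expands_def by (intro allI has_sum_0) auto

lemma hardy_zero: "(\<lambda>x. 0) \<in> hardy"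
  by (rule hardyI[OF holomorphic2_on_const expands_zero]) simp

lemma hardy_add: "f \<in> hardy \<Longrightarrow> g \<in> hardy \<Longrightarrow> (\<lambda>x. f x + g x) \<in> hardy"
  by (rule hardyI[OF holomorphic2_on_add expands_add square_summable_add])
     (auto intro: hardy_holomorphic expands_coeffs square_summable_coeffs)

lemma hardy_scale: "f \<in> hardy \<Longrightarrow> (\<lambda>x. c * f x) \<in> hardy"
  by (rule hardyI[OF holomorphic2_on_mult[OF holomorphic2_on_const] expands_scale square_summable_scale])
     (auto intro: hardy_holomorphic expands_coeffs square_summable_coeffs)

lemma hardy_diff: "f \<in> hardy \<Longrightarrow> g \<in> hardy \<Longrightarrow> (\<lambda>x. f x - g x) \<in> hardy"
  using hardy_add[of f "\<lambda>x. -1 * g x"] hardy_scale[of g "-1"] by simp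

lemma hardy_sum: "(\<And>m. m \<in> I \<Longrightarrow> F m \<in> hardy) \<Longrightarrow> (\<lambda>x. \<Sum>m\<in>I. F m x) \<in> hardy"
  by (induction I rule: infinite_finite_induct) (auto intro: hardy_add hardy_zero)

lemma coeffs_zero: "hardy_coeffs (\<lambda>x. 0) = (\<lambda>n. 0)"
  by (rule coeffs_eqI[OF expands_zero])

lemma coeffs_add: "f \<in> hardy \<Longrightarrow> g \<in> hardy \<Longrightarrow> hardy_coeffs (\<lambda>x. f x + g x) = (\<lambda>n. hardy_coeffs f n + hardy_coeffs g n)"
  by (intro coeffs_eqI expands_add expands_coeffs)

lemma coeffs_scale: "f \<in> hardy \<Longrightarrow> hardy_coeffs (\<lambda>x. c * f x) = (\<lambda>n. c * hardy_coeffs f n)"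
  by (intro coeffs_eqI expands_scale expands_coeffs)

lemma coeffs_sum: "(\<And>m. m \<in> I \<Longrightarrow> F m \<in> hardy) \<Longrightarrow> hardy_coeffs (\<lambda>x. \<Sum>m\<in>I. F m x) = (\<lambda>n. \<Sum>m\<in>I. hardy_coeffs (F m) n)"
  by (induction I rule: infinite_finite_induct) (simp_all add: coeffs_zero coeffs_add hardy_sum)

lemma coeffs_eq_0_imp:
  assumes "f \<in> hardy" "hardy_coeffs f = (\<lambda>n. 0)" shows "f = (\<lambda>x. 0)"
proof
  fix x
  have "((\<lambda>(i, j). hardy_coeffs f (i, j) * hardy_basis i j x) has_sum f x) UNIV"
    using expands_coeffs[OF assms(1)] unfolding expands_def by blast
  moreover have "((\<lambda>(i, j). hardy_coeffs f (i, j) * hardy_basis i j x) has_sum 0) UNIV"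
    by (intro has_sum_0) (auto simp: assms(2))
  ultimately show "f x = 0" by (rule has_sum_unique)
qed

lemma hardy_norm_coeffs: "f \<in> hardy \<Longrightarrow> (hardy_norm f)\<^sup>2 = norm2 (hardy_coeffs f)"
  by (intro hardy_norm_expands expands_coeffs square_summable_coeffs)

lemma hardy_norm_nonneg: "f \<in> hardy \<Longrightarrow> 0 \<le> hardy_norm f"
proof -
  assume f: "f \<in> hardy"
  have "hardy_mean f s t \<le> (SUP (s, t)\<in>{0<..<1} \<times> {0<..<1}. hardy_mean f s t)" if "s \<in> {0<..<1}" "t \<in> {0<..<1}" for s t
    using cSUP_upper[of "(s, t)" "{0<..<1} \<times> {0<..<1}" "\<lambda>(s, t). hardy_mean f s t"] that f
    unfolding hardy_def by auto
  from this[of "1/2" "1/2"] have "hardy_mean f (1/2) (1/2) \<le> (SUP (s, t)\<in>{0<..<1} \<times> {0<..<1}. hardy_mean f s t)" by simp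
  moreover have "0 \<le> hardy_mean f (1/2) (1/2)"
    by (rule has_sum_nonneg[OF hardy_mean_expands[OF expands_coeffs[OF f]]]) auto
  ultimately show ?thesis unfolding hardy_norm_def by simp
qed

text \<open>The fourth roots of unity cancel all terms except \<open>a * cnj b\<close>, so polarizing the norm coefficient
  by coefficient gives the inner product of sequences.\<close>

lemma polarization:
  fixes a b :: complex
  shows "(\<Sum>k<4. \<i> ^ k * of_real ((norm (a + \<i> ^ k * b))\<^sup>2)) = 4 * (a * cnj b)"
  unfolding complex_norm_square by (simp add: eval_nat_numeral algebra_simps)

lemma hardy_inner_has_sum:
  assumes f: "f \<in> hardy" and g: "g \<in> hardy"
  shows "((\<lambda>n. hardy_coeffs f n * cnj (hardy_coeffs g n)) has_sum hardy_inner f g) UNIV"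
proof -
  have 1: "((\<lambda>n. \<i> ^ k * of_real ((norm (hardy_coeffs f n + \<i> ^ k * hardy_coeffs g n))\<^sup>2)) has_sum
         \<i> ^ k * of_real ((hardy_norm (\<lambda>x. f x + \<i> ^ k * g x))\<^sup>2)) UNIV" for k
  proof (intro has_sum_cmult_right has_sum_of_real)
    have h: "(\<lambda>x. f x + \<i> ^ k * g x) \<in> hardy" by (intro hardy_add hardy_scale f g)
    have c: "hardy_coeffs (\<lambda>x. f x + \<i> ^ k * g x) = (\<lambda>n. hardy_coeffs f n + \<i> ^ k * hardy_coeffs g n)"
      by (simp add: coeffs_add coeffs_scale hardy_scale f g)
    show "((\<lambda>n. (norm (hardy_coeffs f n + \<i> ^ k * hardy_coeffs g n))\<^sup>2) has_sum (hardy_norm (\<lambda>x. f x + \<i> ^ k * g x))\<^sup>2) UNIV"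
      unfolding hardy_norm_coeffs[OF h] norm2_def c
      using square_summable_coeffs[OF h] unfolding c by (rule has_sum_infsum)
  qed
  have "((\<lambda>n. \<Sum>k<m. \<i> ^ k * of_real ((norm (hardy_coeffs f n + \<i> ^ k * hardy_coeffs g n))\<^sup>2)) has_sum
         (\<Sum>k<m. \<i> ^ k * of_real ((hardy_norm (\<lambda>x. f x + \<i> ^ k * g x))\<^sup>2))) UNIV" for m :: nat
    by (induction m) (auto intro!: has_sum_add 1 simp del: of_real_power)
  from has_sum_cmult_right[OF this[of 4], of "1/4"] show ?thesis
    unfolding polarization hardy_inner_def by simp
qed

lemma hardy_inner_eqI:
  "f \<in> hardy \<Longrightarrow> g \<in> hardy \<Longrightarrow> ((\<lambda>n. hardy_coeffs f n * cnj (hardy_coeffs g n)) has_sum c) UNIV \<Longrightarrow> hardy_inner f g = c"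
  using hardy_inner_has_sum has_sum_unique by blast

lemma hardy_inner_add_left:
  assumes "f \<in> hardy" "g \<in> hardy" "h \<in> hardy"
  shows "hardy_inner (\<lambda>x. f x + g x) h = hardy_inner f h + hardy_inner g h"
  by (rule hardy_inner_eqI)
     (use has_sum_add[OF hardy_inner_has_sum[OF assms(1,3)] hardy_inner_has_sum[OF assms(2,3)]] in
       \<open>simp_all add: assms hardy_add coeffs_add distrib_right\<close>)

lemma hardy_inner_add_right:
  assumes "f \<in> hardy" "g \<in> hardy" "h \<in> hardy"
  shows "hardy_inner f (\<lambda>x. g x + h x) = hardy_inner f g + hardy_inner f h"
  by (rule hardy_inner_eqI)
     (use has_sum_add[OF hardy_inner_has_sum[OF assms(1,2)] hardy_inner_has_sum[OF assms(1,3)]] in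
       \<open>simp_all add: assms hardy_add coeffs_add distrib_left\<close>)

lemma hardy_inner_scale_left:
  assumes "f \<in> hardy" "g \<in> hardy"
  shows "hardy_inner (\<lambda>x. c * f x) g = c * hardy_inner f g"
  by (rule hardy_inner_eqI)
     (use has_sum_cmult_right[OF hardy_inner_has_sum[OF assms], of c] in
       \<open>simp_all add: assms hardy_scale coeffs_scale mult.assoc\<close>)

lemma hardy_inner_scale_right:
  assumes "f \<in> hardy" "g \<in> hardy"
  shows "hardy_inner f (\<lambda>x. c * g x) = cnj c * hardy_inner f g"
  by (rule hardy_inner_eqI)
     (use has_sum_cmult_right[OF hardy_inner_has_sum[OF assms], of "cnj c"] in
       \<open>simp_all add: assms hardy_scale coeffs_scale mult.left_commute\<close>)

lemma hardy_inner_diff_left: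
  assumes "f \<in> hardy" "g \<in> hardy" "h \<in> hardy"
  shows "hardy_inner (\<lambda>x. f x - g x) h = hardy_inner f h - hardy_inner g h"
  using hardy_inner_add_left[OF assms(1) hardy_scale[OF assms(2), of "-1"] assms(3)]
    hardy_inner_scale_left[OF assms(2,3), of "-1"] by simp

lemma hardy_inner_zero_right: "hardy_inner f (\<lambda>x. 0) = 0"
  unfolding hardy_inner_def by (simp add: eval_nat_numeral)

lemma hardy_inner_zero_left: "g \<in> hardy \<Longrightarrow> hardy_inner (\<lambda>x. 0) g = 0"
  by (rule hardy_inner_eqI) (auto simp: hardy_zero coeffs_zero)

lemma hardy_inner_self_eq_0_iff:
  assumes f: "f \<in> hardy" and 0: "hardy_inner f f = 0"
  shows "f = (\<lambda>x. 0)"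
proof (rule coeffs_eq_0_imp[OF f])
  have "((\<lambda>n. of_real ((norm (hardy_coeffs f n))\<^sup>2)) has_sum (of_real 0 :: complex)) UNIV"
    using hardy_inner_has_sum[OF f f] 0 by (simp add: complex_norm_square del: of_real_power)
  then have "((\<lambda>n. (norm (hardy_coeffs f n))\<^sup>2) has_sum 0) UNIV"
    by (simp only: has_sum_of_real_iff)
  then have "(norm (hardy_coeffs f n))\<^sup>2 = 0" for n
    by (rule nonneg_has_sum_le_0D) auto
  then show "hardy_coeffs f = (\<lambda>n. 0)" by auto
qed

lemma hardy_cauchy_schwarz:
  assumes f: "f \<in> hardy" and g: "g \<in> hardy"
  shows "norm (hardy_inner f g) \<le> hardy_norm f * hardy_norm g"
proof (rule tendsto_upperbound)
  show "((\<lambda>F. norm (\<Sum>n\<in>F. hardy_coeffs f n * cnj (hardy_coeffs g n))) \<longlongrightarrow> norm (hardy_inner f g)) (finite_subsets_at_top UNIV)"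
    using hardy_inner_has_sum[OF f g] unfolding has_sum_def by (rule tendsto_norm)
  have L2: "L2_set (\<lambda>n. norm (hardy_coeffs h n)) F \<le> hardy_norm h" if h: "h \<in> hardy" and F: "finite F" for h F
  proof -
    have "(\<Sum>n\<in>F. (norm (hardy_coeffs h n))\<^sup>2) \<le> (hardy_norm h)\<^sup>2"
      unfolding hardy_norm_coeffs[OF h] norm2_def
      by (rule finite_sum_le_infsum[OF square_summable_coeffs[OF h] F]) auto
    then show ?thesis
      unfolding L2_set_def by (rule real_le_lsqrt[OF hardy_norm_nonneg[OF h]])
  qed
  show "\<forall>\<^sub>F F in finite_subsets_at_top UNIV. norm (\<Sum>n\<in>F. hardy_coeffs f n * cnj (hardy_coeffs g n)) \<le> hardy_norm f * hardy_norm g"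
  proof (rule eventually_finite_subsets_at_top_weakI)
    fix F :: "(nat \<times> nat) set" assume F: "finite F"
    have "norm (\<Sum>n\<in>F. hardy_coeffs f n * cnj (hardy_coeffs g n)) \<le> (\<Sum>n\<in>F. \<bar>norm (hardy_coeffs f n)\<bar> * \<bar>norm (hardy_coeffs g n)\<bar>)"
      by (rule order_trans[OF norm_sum]) (simp add: norm_mult)
    also have "\<dots> \<le> L2_set (\<lambda>n. norm (hardy_coeffs f n)) F * L2_set (\<lambda>n. norm (hardy_coeffs g n)) F"
      by (rule L2_set_mult_ineq)
    also have "\<dots> \<le> hardy_norm f * hardy_norm g"
      by (intro mult_mono L2 f g F hardy_norm_nonneg L2_set_nonneg)
    finally show "norm (\<Sum>n\<in>F. hardy_coeffs f n * cnj (hardy_coeffs g n)) \<le> hardy_norm f * hardy_norm g" .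
  qed
qed simp

text \<open>The Cauchy-Schwarz inequality makes \<open>f \<mapsto> hardy_inner f g\<close> continuous.\<close>

lemma hardy_lim_inner_eq_0:
  assumes F: "\<And>n. F n \<in> hardy" "\<And>n. hardy_inner (F n) g = 0" and f: "f \<in> hardy" and g: "g \<in> hardy"
    and lim: "hardy_lim F f"
  shows "hardy_inner f g = 0"
proof -
  have "norm (hardy_inner f g) \<le> 0"
  proof (rule tendsto_lowerbound)
    show "(\<lambda>n. hardy_norm (\<lambda>x. F n x - f x) * hardy_norm g) \<longlonglongrightarrow> 0"
      using lim unfolding hardy_lim_def by (auto intro: tendsto_eq_intros)
    have "norm (hardy_inner f g) \<le> hardy_norm (\<lambda>x. F n x - f x) * hardy_norm g" for n
      using hardy_cauchy_schwarz[OF hardy_diff[OF F(1) f] g, of n]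
      by (simp add: hardy_inner_diff_left F f g)
    then show "\<forall>\<^sub>F n in sequentially. norm (hardy_inner f g) \<le> hardy_norm (\<lambda>x. F n x - f x) * hardy_norm g"
      by simp
  qed simp
  then show ?thesis by simp
qed

lemma closed_subspace_orth_compl:
  assumes V: "V \<subseteq> hardy"
  shows "closed_subspace (orth_compl V)"
  unfolding closed_subspace_def
proof (intro conjI ballI allI impI)
  show "orth_compl V \<subseteq> hardy" by (auto simp: orth_compl_def)
  show "(\<lambda>x. 0) \<in> orth_compl V"
    using V by (auto simp: orth_compl_def hardy_zero hardy_inner_zero_left)
  show "(\<lambda>x. f x + g x) \<in> orth_compl V" if "f \<in> orth_compl V" "g \<in> orth_compl V" for f g
    using V that by (auto simp: orth_compl_def hardy_add hardy_inner_add_left subset_iff)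
  show "(\<lambda>x. c * f x) \<in> orth_compl V" if "f \<in> orth_compl V" for c f
    using V that by (auto simp: orth_compl_def hardy_scale hardy_inner_scale_left subset_iff)
  show "f \<in> orth_compl V" if "(\<forall>n. F n \<in> orth_compl V) \<and> f \<in> hardy \<and> hardy_lim F f" for F f
    using V that hardy_lim_inner_eq_0[of F _ f] by (auto simp: orth_compl_def subset_iff)
qed

section \<open>Monomial multiplication and the backward shift\<close>

definition shift :: "nat \<Rightarrow> nat \<Rightarrow> (nat \<times> nat \<Rightarrow> complex) \<Rightarrow> nat \<times> nat \<Rightarrow> complex" where
  "shift a b A = (\<lambda>(i, j). if a \<le> i \<and> b \<le> j then A (i - a, j - b) else 0)"

text \<open>A sum over the quadrant \<open>{a..} \<times> {b..}\<close> is a sum over all index pairs, reindexed by translation.\<close>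

lemma has_sum_shift:
  fixes F G :: "nat \<times> nat \<Rightarrow> 'a::{topological_comm_monoid_add, t2_space}"
  assumes "\<And>i j. G (i + a, j + b) = F (i, j)" and "\<And>i j. \<not> (a \<le> i \<and> b \<le> j) \<Longrightarrow> G (i, j) = 0"
  shows "(G has_sum c) UNIV \<longleftrightarrow> (F has_sum c) UNIV"
proof -
  define \<tau> where "\<tau> = (\<lambda>(i::nat, j::nat). (i + a, j + b))"
  have inj: "inj \<tau>" by (auto simp: inj_def \<tau>_def)
  have "(G has_sum c) UNIV \<longleftrightarrow> (G has_sum c) (range \<tau>)"
  proof (rule has_sum_cong_neutral)
    fix n assume "n \<in> UNIV - range \<tau>"
    obtain i j where n: "n = (i, j)" by (cases n)
    have "\<not> (a \<le> i \<and> b \<le> j)"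
    proof
      assume "a \<le> i \<and> b \<le> j"
      then have "n = \<tau> (i - a, j - b)" by (simp add: n \<tau>_def)
      then show False using \<open>n \<in> UNIV - range \<tau>\<close> by blast
    qed
    then show "G n = 0" unfolding n by (rule assms(2))
  qed auto
  also have "\<dots> \<longleftrightarrow> (G \<circ> \<tau> has_sum c) UNIV"
    by (rule has_sum_reindex[OF inj])
  also have "G \<circ> \<tau> = F"
    by (auto simp: \<tau>_def assms(1))
  finally show ?thesis .
qed

text \<open>Multiplication by \<open>z ^ k * w ^ l\<close>. A single operator for all monomials avoids separate treatment
  of \<open>mult_z\<close> and \<open>mult_w\<close> and their iterates.\<close>

definition monom_mult :: "nat \<Rightarrow> nat \<Rightarrow> (complex \<times> complex \<Rightarrow> complex) \<Rightarrow> complex \<times> complex \<Rightarrow> complex" where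
  "monom_mult k l f = (\<lambda>x. fst x ^ k * snd x ^ l * f x)"

lemma mult_z_eq: "mult_z f = monom_mult 1 0 f" and mult_w_eq: "mult_w f = monom_mult 0 1 f"
  by (auto simp: mult_z_def mult_w_def monom_mult_def)

text \<open>Since \<open>z = (z / w) * w\<close>, a factor \<open>z\<close> raises both indices and a factor \<open>w\<close> only the second. The
  degree \<open>i + j\<close> thus grows by \<open>2 * k + l\<close>.\<close>

lemma monom_mult_basis: "monom_mult k l (hardy_basis i j) = hardy_basis (i + k) (j + (k + l))"
proof
  fix x :: "complex \<times> complex"
  obtain z w where x: "x = (z, w)" by (cases x)
  show "monom_mult k l (hardy_basis i j) x = hardy_basis (i + k) (j + (k + l)) x"
  proof (cases "x \<in> hartogs_triangle")
    case True
    then have "w \<noteq> 0" by (auto simp: x hartogs_triangle_def)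
    with True show ?thesis
      by (simp add: x monom_mult_def hardy_basis_def power_add power_divide)
  qed (simp add: x monom_mult_def hardy_basis_def)
qed

lemma expands_monom_mult:
  assumes "expands f A"
  shows "expands (monom_mult k l f) (shift k (k + l) A)"
  unfolding expands_def
proof
  fix x
  have "((\<lambda>(i, j). A (i, j) * hardy_basis i j x) has_sum f x) UNIV"
    using assms unfolding expands_def by blast
  from has_sum_cmult_right[OF this, of "fst x ^ k * snd x ^ l"]
  have "((\<lambda>(i, j). A (i, j) * hardy_basis (i + k) (j + (k + l)) x) has_sum monom_mult k l f x) UNIV"
    unfolding monom_mult_basis[symmetric] by (simp add: monom_mult_def case_prod_unfold mult_ac)
  then show "((\<lambda>(i, j). shift k (k + l) A (i, j) * hardy_basis i j x) has_sum monom_mult k l f x) UNIV"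
    by (subst has_sum_shift[where a = k and b = "k + l"]) (auto simp: shift_def)
qed

lemma square_summable_shift: "square_summable A \<Longrightarrow> square_summable (shift a b A)"
  unfolding summable_on_def
  by (subst has_sum_shift[where a = a and b = b and F = "\<lambda>n. (norm (A n))\<^sup>2"]) (auto simp: shift_def)

lemma holomorphic2_on_power: "holomorphic2_on f S \<Longrightarrow> holomorphic2_on (\<lambda>x. f x ^ n) S"
  by (induction n) (auto intro: holomorphic2_on_const holomorphic2_on_mult)

lemma hardy_monom_mult:
  assumes "f \<in> hardy"
  shows "monom_mult k l f \<in> hardy" "hardy_coeffs (monom_mult k l f) = shift k (k + l) (hardy_coeffs f)"
proof -
  note e = expands_monom_mult[OF expands_coeffs[OF assms], of k l]
  show "hardy_coeffs (monom_mult k l f) = shift k (k + l) (hardy_coeffs f)" by (rule coeffs_eqI[OF e])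
  show "monom_mult k l f \<in> hardy"
  proof (rule hardyI[OF _ e square_summable_shift[OF square_summable_coeffs[OF assms]]])
    show "holomorphic2_on (monom_mult k l f) hartogs_triangle"
      unfolding monom_mult_def
      by (intro holomorphic2_on_mult holomorphic2_on_power holomorphic2_on_proj hardy_holomorphic assms)
  qed
qed

lemma holomorphic2_on_divide:
  assumes "holomorphic2_on f S" "holomorphic2_on g S" "\<And>x. x \<in> S \<Longrightarrow> g x \<noteq> 0"
  shows "holomorphic2_on (\<lambda>x. f x / g x) S"
proof -
  have "holomorphic2_on (\<lambda>x. inverse (g x)) S"
    by (rule holomorphic2_on_compose[OF assms(2)]) (rule DERIV_inverse, rule assms(3))
  from holomorphic2_on_mult[OF assms(1) this] show ?thesis by (simp add: divide_inverse)
qed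

text \<open>The function is \<open>h = (f - f\<^sub>0) / w\<close> with \<open>f\<^sub>0\<close> the part of the expansion with \<open>j = 0\<close>. This part is a
  power series in the single variable \<open>z / w\<close>, divided by \<open>w\<close>, so \<open>h\<close> is holomorphic without
  differentiating a double series. It serves as the image of \<open>f\<close> under the adjoint of \<open>mult_w\<close>.\<close>

lemma backward_shift_w:
  assumes f: "f \<in> hardy"
  obtains h where "h \<in> hardy" "\<And>i j. hardy_coeffs h (i, j) = hardy_coeffs f (i, Suc j)"
proof -
  define A where "A = hardy_coeffs f"
  have fA: "((\<lambda>(i, j). A (i, j) * hardy_basis i j x) has_sum f x) UNIV" for x
    using expands_coeffs[OF f] unfolding expands_def A_def by blast
  \<comment> \<open>The value \<open>w = 1 / 2\<close> is arbitrary; any nonzero \<open>w\<close> in the disc shows that the row \<open>j = 0\<close> converges.\<close>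
  have row: "(\<lambda>i. A (i, 0) * u ^ i) summable_on UNIV" if u: "norm u < 1" for u
  proof -
    have x: "(u / 2, 1 / 2) \<in> hartogs_triangle" using u by (simp add: hartogs_triangle_def norm_divide)
    have "(\<lambda>(i, j). A (i, j) * hardy_basis i j (u / 2, 1 / 2)) summable_on UNIV \<times> UNIV"
      using has_sum_imp_summable[OF fA] by simp
    then have "(\<lambda>(i, j). A (i, j) * hardy_basis i j (u / 2, 1 / 2)) summable_on range (\<lambda>i. (i, 0))"
      by (rule summable_on_subset_banach) auto
    then have "(\<lambda>i. A (i, 0) * hardy_basis i 0 (u / 2, 1 / 2)) summable_on UNIV"
      by (subst (asm) summable_on_reindex) (auto simp: inj_def o_def)
    from summable_on_cmult_right[OF this, of "1/2"] show ?thesis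
      using x by (simp add: hardy_basis_def)
  qed
  define G where "G = (\<lambda>u. \<Sum>i. A (i, 0) * u ^ i)"
  have G: "((\<lambda>i. A (i, 0) * u ^ i) has_sum G u) UNIV" if "norm u < 1" for u
    using has_sum_infsum[OF row[OF that]] sums_unique[OF has_sum_imp_sums[OF has_sum_infsum[OF row[OF that]]]]
    unfolding G_def by simp
  have G': "(G has_field_derivative (\<Sum>n. diffs (\<lambda>i. A (i, 0)) n * u ^ n)) (at u)" if "norm u < 1" for u
    unfolding G_def by (rule termdiffs_strong'[OF summable_on_imp_summable[OF row] that])
  define h where "h = (\<lambda>x. if x \<in> hartogs_triangle then (f x + -1 * (G (fst x / snd x) / snd x)) / snd x else 0)"
  have nz: "snd x \<noteq> 0" "norm (fst x / snd x) < 1" if "x \<in> hartogs_triangle" for x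
    using that by (auto simp: hartogs_triangle_def norm_divide divide_less_eq_1)
  have holo: "holomorphic2_on h hartogs_triangle"
  proof (rule holomorphic2_on_cong_open[OF _ open_hartogs_triangle])
    have "holomorphic2_on (\<lambda>x. G (fst x / snd x)) hartogs_triangle"
      by (rule holomorphic2_on_compose[OF holomorphic2_on_divide[OF holomorphic2_on_proj] G'])
         (simp_all add: nz)
    then show "holomorphic2_on (\<lambda>x. (f x + -1 * (G (fst x / snd x) / snd x)) / snd x) hartogs_triangle"
      by (intro holomorphic2_on_divide holomorphic2_on_add holomorphic2_on_mult holomorphic2_on_const
          holomorphic2_on_proj hardy_holomorphic[OF f]) (simp_all add: nz)
  qed (simp add: h_def)
  have exp: "expands h (\<lambda>(i, j). A (i, Suc j))"
  proof (rule expandsI)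
    fix x assume x: "x \<in> hartogs_triangle"
    obtain z w where xzw: "x = (z, w)" by (cases x)
    have w: "w \<noteq> 0" "norm (z / w) < 1" using nz[OF x] by (simp_all add: xzw)
    \<comment> \<open>The terms with \<open>j = 0\<close> sum to \<open>G (z / w) / w\<close>; removing them and dividing by \<open>w\<close> shifts the index.\<close>
    have "((\<lambda>n. A (n, 0) * hardy_basis n 0 x) has_sum G (z / w) / w) UNIV"
      using has_sum_cmult_left[OF G[OF w(2)], of "1 / w"] x by (simp add: xzw hardy_basis_def)
    then have "(((\<lambda>(i, j). A (i, j) * hardy_basis i j x) \<circ> (\<lambda>i. (i, 0))) has_sum G (z / w) / w) UNIV"
      by (simp add: o_def)
    then have "((\<lambda>(i, j). A (i, j) * hardy_basis i j x) has_sum G (z / w) / w) (range (\<lambda>i. (i, 0)))"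
      by (subst has_sum_reindex) (auto simp: inj_def)
    then have "((\<lambda>(i, j). if j = 0 then A (i, j) * hardy_basis i j x else 0) has_sum G (z / w) / w) UNIV"
      by (subst has_sum_cong_neutral[where T = "range (\<lambda>i. (i, 0))" and g = "\<lambda>(i, j). A (i, j) * hardy_basis i j x"]) auto
    from has_sum_add[OF fA[of x] has_sum_cmult_right[OF this, of "-1"]]
    have "((\<lambda>(i, j). if j = 0 then 0 else A (i, j) * hardy_basis i j x) has_sum f x + -1 * (G (z / w) / w)) UNIV"
      by (rule has_sum_cong[THEN iffD1, rotated]) auto
    then have "((\<lambda>(i, j). A (i, Suc j) * hardy_basis i (Suc j) x) has_sum f x + -1 * (G (z / w) / w)) UNIV"
      by (subst (asm) has_sum_shift[where a = 0 and b = 1 and F = "\<lambda>(i, j). A (i, Suc j) * hardy_basis i (Suc j) x"]) auto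
    from has_sum_cmult_left[OF this, of "1 / w"]
    have "((\<lambda>(i, j). A (i, Suc j) * hardy_basis i (Suc j) x * (1 / w)) has_sum h x) UNIV"
      using x by (simp add: h_def xzw case_prod_unfold)
    then have "((\<lambda>(i, j). A (i, Suc j) * (hardy_basis i (Suc j) x * (1 / w))) has_sum h x) UNIV"
      by (simp only: mult.assoc)
    moreover have *: "hardy_basis i (Suc j) x * (1 / w) = hardy_basis i j x" for i j
      using w x by (simp add: xzw hardy_basis_def)
    ultimately show "((\<lambda>(i, j). (case (i, j) of (i, j) \<Rightarrow> A (i, Suc j)) * hardy_basis i j x) has_sum h x) UNIV"
      unfolding * by simp
  qed (simp add: h_def)
  have "square_summable (\<lambda>(i, j). A (i, Suc j))"
  proof -
    have "inj (\<lambda>(i::nat, j). (i, Suc j))" by (auto simp: inj_def)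
    moreover have "(\<lambda>n. (norm (A n))\<^sup>2) summable_on range (\<lambda>(i, j). (i, Suc j))"
      by (rule summable_on_subset_banach[OF square_summable_coeffs[OF f, folded A_def]]) auto
    ultimately show ?thesis
      by (subst (asm) summable_on_reindex) (auto simp: o_def case_prod_unfold)
  qed
  from hardyI[OF holo exp this] have "h \<in> hardy" .
  moreover have "hardy_coeffs h (i, j) = hardy_coeffs f (i, Suc j)" for i j
    using coeffs_eqI[OF exp] by (simp add: A_def)
  ultimately show thesis by (rule that)
qed

lemma coeffs_basis: "hardy_coeffs (hardy_basis i j) = (\<lambda>n. if n = (i, j) then 1 else 0)"
  by (rule coeffs_eqI[OF expands_basis])

lemma hardy_basis_in_hardy: "hardy_basis i j \<in> hardy"
proof (rule hardyI[OF _ expands_basis])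
  have "holomorphic2_on (\<lambda>x. 1 / snd x * (fst x / snd x) ^ i * snd x ^ j) hartogs_triangle"
    by (intro holomorphic2_on_mult holomorphic2_on_divide holomorphic2_on_power holomorphic2_on_const holomorphic2_on_proj)
       (auto simp: hartogs_triangle_def)
  then show "holomorphic2_on (hardy_basis i j) hartogs_triangle"
    by (rule holomorphic2_on_cong_open[OF _ open_hartogs_triangle]) (auto simp: hardy_basis_def)
  show "square_summable (\<lambda>n. if n = (i, j) then 1 else (0::complex))"
    by (rule has_sum_imp_summable[where S = 1], rule has_sum_finite_neutralI[of "{(i, j)}"]) (auto split: if_splits)
qed

lemma hardy_inner_basis:
  assumes "f \<in> hardy" shows "hardy_inner f (hardy_basis i j) = hardy_coeffs f (i, j)"
  by (rule hardy_inner_eqI[OF assms hardy_basis_in_hardy], rule has_sum_finite_neutralI[of "{(i, j)}"])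
     (auto simp: coeffs_basis split: if_splits)

section \<open>Graded quotient modules of polynomials\<close>

text \<open>The polynomial with terms \<open>(\<beta>, k, l)\<close>. Lists permit repeated exponents, so polynomials given as a
  sum of several parts need not be collected, and any chosen term can be moved to the front.\<close>

definition poly_terms :: "(complex \<times> nat \<times> nat) list \<Rightarrow> complex \<times> complex \<Rightarrow> complex" where
  "poly_terms L = (\<lambda>x. \<Sum>(\<beta>, k, l)\<leftarrow>L. \<beta> * fst x ^ k * snd x ^ l)"

lemma poly_terms_mult:
  assumes g: "g \<in> hardy"
  shows "(\<lambda>x. poly_terms L x * g x) \<in> hardy" (is ?A)
    and "f \<in> hardy \<Longrightarrow> hardy_inner f (\<lambda>x. poly_terms L x * g x) = (\<Sum>(\<beta>, k, l)\<leftarrow>L. cnj \<beta> * hardy_inner f (monom_mult k l g))"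
proof -
  have "(\<lambda>x. poly_terms L x * g x) \<in> hardy \<and> (f \<in> hardy \<longrightarrow>
     hardy_inner f (\<lambda>x. poly_terms L x * g x) = (\<Sum>(\<beta>, k, l)\<leftarrow>L. cnj \<beta> * hardy_inner f (monom_mult k l g)))" for f
  proof (induction L)
    case Nil
    then show ?case by (simp add: poly_terms_def hardy_zero hardy_inner_zero_right)
  next
    case (Cons t L)
    obtain \<beta> k l where t: "t = (\<beta>, k, l)" by (cases t)
    have eq: "(\<lambda>x. poly_terms (t # L) x * g x) = (\<lambda>x. \<beta> * monom_mult k l g x + poly_terms L x * g x)"
      by (simp add: poly_terms_def monom_mult_def t algebra_simps)
    show ?case
      unfolding eq using Cons hardy_monom_mult(1)[OF g, of k l]
      by (simp add: hardy_add hardy_scale hardy_inner_add_right hardy_inner_scale_right t)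
  qed
  then show ?A and "f \<in> hardy \<Longrightarrow> hardy_inner f (\<lambda>x. poly_terms L x * g x) = (\<Sum>(\<beta>, k, l)\<leftarrow>L. cnj \<beta> * hardy_inner f (monom_mult k l g))"
    by blast+
qed

lemma homog_space_coeffs:
  assumes "f \<in> homog_space m"
  shows "f \<in> hardy" and "i + j \<noteq> m \<Longrightarrow> hardy_coeffs f (i, j) = 0"
proof -
  obtain c where f: "f = (\<lambda>x. \<Sum>j\<le>m. c j * hardy_basis (m - j) j x)"
    using assms unfolding homog_space_def by blast
  have h: "(\<lambda>x. c j * hardy_basis (m - j) j x) \<in> hardy" for j
    by (intro hardy_scale hardy_basis_in_hardy)
  show "f \<in> hardy" unfolding f by (intro hardy_sum h)
  show "hardy_coeffs f (i, j) = 0" if "i + j \<noteq> m"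
    unfolding f using that by (subst coeffs_sum) (auto simp: h coeffs_scale hardy_basis_in_hardy coeffs_basis intro!: sum.neutral)
qed

text \<open>Test \<open>f\<close> against the product of the polynomial with the basis function of index
  \<open>(i - k, j - (k + l))\<close>, which the leading monomial moves to \<open>(i, j)\<close>. Every other term of the
  polynomial moves it to a degree different from \<open>m\<close>, where \<open>f\<close> has no coefficients.\<close>

lemma homogeneous_orthogonal_coeff_eq_0:
  assumes f: "f \<in> homog_space m" "f \<in> principal_quotient (poly_terms ((\<gamma>, k, l) # L))"
    and \<gamma>: "\<gamma> \<noteq> 0"
    and L: "\<And>\<beta> k' l'. (\<beta>, k', l') \<in> set L \<Longrightarrow> \<beta> = 0 \<or> 2 * k' + l' \<noteq> 2 * k + l"
    and ij: "k \<le> i" "k + l \<le> j"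
  shows "hardy_coeffs f (i, j) = 0"
proof (cases "i + j = m")
  case True
  define e where "e = hardy_basis (i - k) (j - (k + l))"
  have fh: "f \<in> hardy" using homog_space_coeffs[OF f(1)] by simp
  have "hardy_inner f (\<lambda>x. poly_terms ((\<gamma>, k, l) # L) x * e x) = 0"
    using f(2) hardy_basis_in_hardy unfolding principal_quotient_def orth_compl_def e_def by blast
  then have "cnj \<gamma> * hardy_inner f (monom_mult k l e) + (\<Sum>(\<beta>, k', l')\<leftarrow>L. cnj \<beta> * hardy_inner f (monom_mult k' l' e)) = 0"
    using poly_terms_mult(2)[OF hardy_basis_in_hardy fh] by (simp add: e_def)
  moreover have "hardy_inner f (monom_mult k l e) = hardy_coeffs f (i, j)"
    using ij by (simp add: e_def monom_mult_basis hardy_inner_basis fh)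
  moreover have "(\<Sum>(\<beta>, k', l')\<leftarrow>L. cnj \<beta> * hardy_inner f (monom_mult k' l' e)) = 0"
  proof -
    have "map (\<lambda>(\<beta>, k', l'). cnj \<beta> * hardy_inner f (monom_mult k' l' e)) L = map (\<lambda>_. 0) L"
    proof (rule map_cong[OF refl], clarify)
      fix \<beta> k' l' assume "(\<beta>, k', l') \<in> set L"
      from L[OF this] show "cnj \<beta> * hardy_inner f (monom_mult k' l' e) = 0"
      proof
        assume "2 * k' + l' \<noteq> 2 * k + l"
        then have "i - k + k' + (j - (k + l) + (k' + l')) \<noteq> m" using True ij by arith
        then show ?thesis
          by (simp add: e_def monom_mult_basis hardy_inner_basis fh homog_space_coeffs(2)[OF f(1)])
      qed simp
    qed
    then show ?thesis by (simp only: sum_list_0)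
  qed
  ultimately show ?thesis using \<gamma> by simp
next
  case False
  then show ?thesis by (rule homog_space_coeffs(2)[OF f(1)])
qed

text \<open>The coefficients of elements of the module are supported on the two axes, and those of \<open>z * g\<close> off
  the axes. So the compression of \<open>mult_z\<close> is zero. Existence of the projections of \<open>w * f\<close> is never
  at issue, because the adjoint of the zero operator takes the value zero at any argument. What
  remains is that the module is closed and invariant under the adjoint of \<open>mult_w\<close>, which holds as
  \<open>w * p * g\<close> is again a multiple of \<open>p\<close>.\<close>

lemma doubly_commuting_if_no_mixed_terms:
  assumes graded: "principal_quotient (poly_terms L) \<subseteq> hilbert_sum (\<lambda>m. homog_space m \<inter> principal_quotient (poly_terms L))"
    and mixed: "\<And>m f i j. f \<in> homog_space m \<Longrightarrow> f \<in> principal_quotient (poly_terms L) \<Longrightarrow>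
      1 \<le> i \<Longrightarrow> 1 \<le> j \<Longrightarrow> hardy_coeffs f (i, j) = 0"
  shows "doubly_commuting (principal_quotient (poly_terms L))"
proof -
  define Q where "Q = principal_quotient (poly_terms L)"
  have Q_hardy: "f \<in> hardy" if "f \<in> Q" for f
    using that by (auto simp: Q_def principal_quotient_def orth_compl_def)
  have sub: "closed_subspace Q"
    unfolding Q_def principal_quotient_def by (rule closed_subspace_orth_compl) (auto intro: poly_terms_mult)
  have Q_zero: "(\<lambda>x. 0) \<in> Q" using sub by (simp add: closed_subspace_def)
  have mixed_Q: "hardy_coeffs f (i, j) = 0" if f: "f \<in> Q" and ij: "1 \<le> i" "1 \<le> j" for f i j
  proof -
    have "f \<in> hilbert_sum (\<lambda>m. homog_space m \<inter> Q)" using graded f unfolding Q_def by blast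
    then obtain g where g: "\<And>m. g m \<in> homog_space m \<inter> Q" and lim: "hardy_lim (\<lambda>n x. \<Sum>m<n. g m x) f"
      unfolding hilbert_sum_def by blast
    have gh: "g m \<in> hardy" for m using g Q_hardy by blast
    have gij: "hardy_coeffs (g m) (i, j) = 0" for m
      using g[of m] mixed ij by (auto simp: Q_def)
    have "hardy_inner f (hardy_basis i j) = 0"
    proof (rule hardy_lim_inner_eq_0[OF _ _ Q_hardy[OF f] hardy_basis_in_hardy lim])
      show S: "(\<lambda>x. \<Sum>m<n. g m x) \<in> hardy" for n by (intro hardy_sum gh)
      show "hardy_inner (\<lambda>x. \<Sum>m<n. g m x) (hardy_basis i j) = 0" for n
        by (simp add: hardy_inner_basis[OF S] coeffs_sum gh gij)
    qed
    then show ?thesis by (simp add: hardy_inner_basis Q_hardy f)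
  qed
  have shift_mixed: "shift 1 1 B (i, j) = 0 \<or> 1 \<le> i \<and> 1 \<le> j" for B i j
    by (auto simp: shift_def)
  have z_orth: "hardy_inner (mult_z g) f = 0" "hardy_inner f (mult_z g) = 0" if f: "f \<in> Q" and g: "g \<in> hardy" for f g
  proof -
    have "hardy_coeffs f n = 0 \<or> hardy_coeffs (mult_z g) n = 0" for n
    proof (cases n)
      case (Pair i j)
      then show ?thesis
        using mixed_Q[OF f, of i j] shift_mixed[of "hardy_coeffs g" i j]
        by (auto simp: mult_z_eq hardy_monom_mult(2)[OF g])
    qed
    then have s: "((\<lambda>n. hardy_coeffs (mult_z g) n * cnj (hardy_coeffs f n)) has_sum 0) UNIV"
      "((\<lambda>n. hardy_coeffs f n * cnj (hardy_coeffs (mult_z g) n)) has_sum 0) UNIV"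
      by (intro has_sum_0; metis mult_zero_left mult_zero_right complex_cnj_zero)+
    have "mult_z g \<in> hardy" unfolding mult_z_eq by (rule hardy_monom_mult(1)[OF g])
    with s show "hardy_inner (mult_z g) f = 0" "hardy_inner f (mult_z g) = 0"
      using Q_hardy[OF f] by (blast intro: hardy_inner_eqI)+
  qed
  have proj_0: "orth_proj Q f = (\<lambda>x. 0)" if f: "f \<in> hardy" and orth: "\<And>g. g \<in> Q \<Longrightarrow> hardy_inner f g = 0" for f
    unfolding orth_proj_def
  proof (rule the_equality)
    show "(\<lambda>x. 0) \<in> Q \<and> (\<forall>g\<in>Q. hardy_inner (\<lambda>x. f x - 0) g = 0)" using Q_zero orth by simp
    fix h assume h: "h \<in> Q \<and> (\<forall>g\<in>Q. hardy_inner (\<lambda>x. f x - h x) g = 0)"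
    then have "hardy_inner h h = 0"
      using orth hardy_inner_diff_left[OF f, of h h] Q_hardy by auto
    then show "h = (\<lambda>x. 0)" using h Q_hardy hardy_inner_self_eq_0_iff by blast
  qed
  have adjoint_0: "adjoint_on V T f = (\<lambda>x. 0)"
    if V: "V \<subseteq> hardy" "(\<lambda>x. 0) \<in> V" and orth: "\<And>g. g \<in> V \<Longrightarrow> hardy_inner f (T g) = 0" for V T f
    unfolding adjoint_on_def
  proof (rule the_equality)
    show "(\<lambda>x. 0) \<in> V \<and> (\<forall>g\<in>V. hardy_inner (\<lambda>x. 0) g = hardy_inner f (T g))"
      using V orth hardy_inner_zero_left by auto
    fix h assume "h \<in> V \<and> (\<forall>g\<in>V. hardy_inner h g = hardy_inner f (T g))"
    then show "h = (\<lambda>x. 0)" using V orth hardy_inner_self_eq_0_iff by auto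
  qed
  have compress_z_0: "compress_z Q f = (\<lambda>x. 0)" if "f \<in> Q" for f
    unfolding compress_z_def
    by (rule proj_0) (use that Q_hardy z_orth in \<open>auto simp: mult_z_eq hardy_monom_mult\<close>)
  have compress_w_0: "compress_w Q (\<lambda>x. 0) = (\<lambda>x. 0)"
  proof -
    have "mult_w (\<lambda>x. 0) = (\<lambda>x. 0)" by (auto simp: mult_w_def)
    then show ?thesis
      unfolding compress_w_def using proj_0[OF hardy_zero] hardy_inner_zero_left Q_hardy by simp
  qed
  have adj_z_0: "adjoint_on Q (compress_z Q) f = (\<lambda>x. 0)" for f
    by (rule adjoint_0) (use Q_hardy Q_zero in \<open>auto simp: compress_z_0 hardy_inner_zero_right\<close>)
  have adj_w: "adjoint_on hardy mult_w f \<in> Q" if f: "f \<in> Q" for f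
  proof -
    obtain h where h: "h \<in> hardy" and hc: "\<And>i j. hardy_coeffs h (i, j) = hardy_coeffs f (i, Suc j)"
      using backward_shift_w[OF Q_hardy[OF f]] by blast
    have adj: "hardy_inner h g = hardy_inner f (mult_w g)" if g: "g \<in> hardy" for g
    proof (rule hardy_inner_eqI[OF h g])
      have "((\<lambda>n. hardy_coeffs f n * cnj (hardy_coeffs (mult_w g) n)) has_sum hardy_inner f (mult_w g)) UNIV"
        using hardy_inner_has_sum[OF Q_hardy[OF f] hardy_monom_mult(1)[OF g, of 0 1]] by (simp add: mult_w_eq)
      then show "((\<lambda>n. hardy_coeffs h n * cnj (hardy_coeffs g n)) has_sum hardy_inner f (mult_w g)) UNIV"
        by (subst (asm) has_sum_shift[where a = 0 and b = 1 and F = "\<lambda>n. hardy_coeffs h n * cnj (hardy_coeffs g n)"])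
           (auto simp: hc mult_w_eq hardy_monom_mult(2)[OF g] shift_def)
    qed
    have "adjoint_on hardy mult_w f = h"
      unfolding adjoint_on_def
    proof (rule the_equality)
      show "h \<in> hardy \<and> (\<forall>g\<in>hardy. hardy_inner h g = hardy_inner f (mult_w g))" using h adj by blast
      fix k assume k: "k \<in> hardy \<and> (\<forall>g\<in>hardy. hardy_inner k g = hardy_inner f (mult_w g))"
      define d where "d = (\<lambda>x. k x - h x)"
      have d: "d \<in> hardy" using k h by (simp add: d_def hardy_diff)
      have "hardy_inner d d = 0"
        using k adj[OF d] d hardy_inner_diff_left[of k h d] h by (simp add: d_def[symmetric])
      from hardy_inner_self_eq_0_iff[OF d this] show "k = h" by (auto simp: d_def fun_eq_iff)
    qed
    moreover have "h \<in> Q"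
      unfolding Q_def principal_quotient_def orth_compl_def
    proof (safe intro!: h)
      fix g assume g: "g \<in> hardy"
      have "mult_w (\<lambda>x. poly_terms L x * g x) = (\<lambda>x. poly_terms L x * mult_w g x)"
        by (auto simp: mult_w_def)
      moreover have "hardy_inner f (\<lambda>x. poly_terms L x * mult_w g x) = 0"
        using f hardy_monom_mult(1)[OF g, of 0 1]
        unfolding Q_def principal_quotient_def orth_compl_def mult_w_eq by blast
      ultimately show "hardy_inner h (\<lambda>x. poly_terms L x * g x) = 0"
        using adj[OF poly_terms_mult(1)[OF g, of L]] by simp
    qed
    ultimately show ?thesis by simp
  qed
  have "adjoint_on hardy mult_z f \<in> Q" if "f \<in> Q" for f
    using adjoint_0[of hardy f mult_z] hardy_zero z_orth(2)[OF that] Q_zero by auto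
  with sub adj_w have "quotient_module Q" by (simp add: quotient_module_def)
  then show ?thesis
    unfolding doubly_commuting_def Q_def[symmetric] by (simp add: adj_z_0 compress_w_0)
qed

theorem proposition4p12:
  fixes a b c :: complex and A :: "nat \<Rightarrow> nat \<Rightarrow> complex" and q r :: "complex poly"
    and p :: "complex \<times> complex \<Rightarrow> complex"
  assumes "finite {(i, j). 1 \<le> i \<and> 1 \<le> j \<and> A i j \<noteq> 0}"
    and "p = (\<lambda>(z, w). a * z + b * w + c * w ^ 2 + w ^ 3 * poly q w + z ^ 2 * poly r z
           + (\<Sum>(i, j) \<in> {(i, j). 1 \<le> i \<and> 1 \<le> j \<and> A i j \<noteq> 0}. A i j * z ^ i * w ^ j))"
    and "principal_quotient p = hilbert_sum (\<lambda>m. homog_space m \<inter> principal_quotient p)"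
    and "b \<noteq> 0 \<or> (a \<noteq> 0 \<and> b = 0 \<and> c = 0)"
  shows "doubly_commuting (principal_quotient p)"
proof -
  define I where "I = {(i, j). 1 \<le> i \<and> 1 \<le> j \<and> A i j \<noteq> 0}"
  obtain ps where ps: "set ps = I" "distinct ps"
    using finite_distinct_list[OF assms(1)] unfolding I_def by blast
  define R where "R = (c, 0, 2) # map (\<lambda>n. (coeff q n, 0, n + 3)) [0..<Suc (degree q)]
    @ map (\<lambda>n. (coeff r n, n + 2, 0)) [0..<Suc (degree r)] @ map (\<lambda>(i, j). (A i j, i, j)) ps"
  have R_weight: "\<beta> = c \<and> k = 0 \<and> l = 2 \<or> 3 \<le> 2 * k + l" if "(\<beta>, k, l) \<in> set R" for \<beta> k l
    using that ps by (auto simp: R_def I_def)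
  have p_eq: "p = poly_terms ((a, 1, 0) # (b, 0, 1) # R)"
  proof
    fix x :: "complex \<times> complex"
    obtain z w where x: "x = (z, w)" by (cases x)
    have "(\<Sum>(i, j)\<leftarrow>ps. A i j * z ^ i * w ^ j) = (\<Sum>(i, j)\<in>I. A i j * z ^ i * w ^ j)"
      by (simp add: sum_list_distinct_conv_sum_set[OF ps(2)] ps(1))
    moreover have "w ^ 3 * poly q w = (\<Sum>n\<leftarrow>[0..<Suc (degree q)]. coeff q n * w ^ (n + 3))"
      unfolding poly_altdef sum_distrib_left interv_sum_list_conv_sum_set_nat set_upt
      by (rule sum.cong) (auto simp: power_add mult_ac)
    moreover have "z ^ 2 * poly r z = (\<Sum>n\<leftarrow>[0..<Suc (degree r)]. coeff r n * z ^ (n + 2))"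
      unfolding poly_altdef sum_distrib_left interv_sum_list_conv_sum_set_nat set_upt
      by (rule sum.cong) (auto simp: power_add power2_eq_square mult_ac)
    ultimately show "p x = poly_terms ((a, 1, 0) # (b, 0, 1) # R) x"
      unfolding assms(2) poly_terms_def R_def x I_def[symmetric]
      by (simp add: o_def case_prod_unfold del: upt_Suc)
  qed
  \<comment> \<open>The leading term is \<open>b * w\<close> or \<open>a * z\<close>, depending on the case; both orders of the list are needed.\<close>
  have p_eq': "p = poly_terms ((b, 0, 1) # (a, 1, 0) # R)"
    unfolding p_eq by (simp add: poly_terms_def fun_eq_iff)
  show ?thesis
    unfolding p_eq
  proof (rule doubly_commuting_if_no_mixed_terms)
    show "principal_quotient (poly_terms ((a, 1, 0) # (b, 0, 1) # R)) \<subseteq>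
        hilbert_sum (\<lambda>m. homog_space m \<inter> principal_quotient (poly_terms ((a, 1, 0) # (b, 0, 1) # R)))"
      using assms(3) unfolding p_eq by blast
    fix m f and i j :: nat
    assume f: "f \<in> homog_space m" "f \<in> principal_quotient (poly_terms ((a, 1, 0) # (b, 0, 1) # R))"
      and ij: "1 \<le> i" "1 \<le> j"
    show "hardy_coeffs f (i, j) = 0"
    proof (cases "b = 0")
      case False
      have f': "f \<in> principal_quotient (poly_terms ((b, 0, 1) # (a, 1, 0) # R))"
        using f(2) p_eq p_eq' by simp
      show ?thesis
        by (rule homogeneous_orthogonal_coeff_eq_0[OF f(1) f' False])
           (use ij in \<open>auto dest: R_weight\<close>)
    next
      case True
      then have "a \<noteq> 0" "c = 0" using assms(4) by auto
      show ?thesis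
        by (rule homogeneous_orthogonal_coeff_eq_0[OF f \<open>a \<noteq> 0\<close>])
           (use ij True \<open>c = 0\<close> in \<open>auto dest: R_weight\<close>)
    qed
  qed
qed

end
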